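(* Let $r \ge 2$ be an integer and let $f_1,\ldots,f_r : \mathbb{Z}\to\mathbb{C}^*$ be group homomorphisms such that the partial products $g_i := \prod_{1\le j\le i} f_j$ satisfy $|g_i(1)|\le 1$ for all $1\le i\le r$. Then the multiple additive $L$-function $L_r(f_1,\ldots,f_r;\ s_1,\ldots,s_r)$ extends to a meromorphic function on $\mathbb{C}^r$, and on $\mathbb{C}^r$ the following identities of meromorphic functions hold: if $f_1(1)=1$, $$L_{r-1}(f_2,\ldots,f_r;\ s_1+s_2-1,s_3,\ldots,s_r) = \sum_{k\ge 0} (s_1-1)_k\, L_r(f_1,\ldots,f_r;\ s_1+k,s_2,\ldots,s_r);$$ if $f_1(1)\neq1$, $$f_1(1)\, L_{r-1}(g_2,f_3,\ldots,f_r;\ s_1+s_2,s_3,\ldots,s_r) + (f_1(1)-1)\, L_r(f_1,\ldots,f_r;\ s_1,\ldots,s_r) = \sum_{k\ge 0} (s_1)_k\, L_r(f_1,\ldots,f_r;\ s_1+k+1,s_2,\ldots,s_r).$$ The series of meromorphic functions on the right hand sides converge normally on every compact subset of $\mathbb{C}^r$.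
   Context: For additive characters $h_1,\ldots,h_d$ (group homomorphisms $\mathbb{Z}\to\mathbb{C}^*$) whose partial products $h_1\cdots h_i$ have absolute value at most $1$ at $1$, the multiple additive $L$-function is defined on $U_d := \{ (s_1,\ldots,s_d) : \Re(s_1+\cdots+s_i) > i \ \forall i\}$ by $$L_d(h_1,\ldots,h_d;\ s_1,\ldots,s_d) := \sum_{n_1>\cdots>n_d>0} \frac{h_1(n_1)\cdots h_d(n_d)}{n_1^{s_1}\cdots n_d^{s_d}};$$ for $d=1$ it is known to extend meromorphically to $\mathbb{C}$. For $s\in\mathbb{C}$ and $k\ge0$, $(s)_k := \frac{s(s+1)\cdots(s+k)}{(k+1)!}$. A family $(h_i)_{i\in I}$ of meromorphic functions on an open $X\subseteq\mathbb{C}^r$ is normally summable on compact subsets of $X$ if for every compact $K\subseteq X$ there is a finite $J\subseteq I$ such that each $h_i$, $i\notin J$, is holomorphic on a neighbourhood of $K$ and $\sum_{i\notin J}\sup_K|h_i|<\infty$. *)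

theory Defs
  imports "HOL-Complex_Analysis.Complex_Analysis"
begin

text \<open>Points of \<open>\<complex>\<^sup>r\<close> are the extensional functions on \<open>{1..r}\<close>.\<close>

definition cspace :: "nat \<Rightarrow> (nat \<Rightarrow> complex) topology" where
  "cspace r = product_topology (\<lambda>_. euclidean) {1..r}"

abbreviation Cn :: "nat \<Rightarrow> (nat \<Rightarrow> complex) set" where
  "Cn r \<equiv> topspace (cspace r)"

text \<open>Holomorphic on an open set: continuous, and holomorphic in each variable separately.\<close>

definition holomorphic_Cn ::
    "nat \<Rightarrow> (nat \<Rightarrow> complex) set \<Rightarrow> ((nat \<Rightarrow> complex) \<Rightarrow> complex) \<Rightarrow> bool" where
  "holomorphic_Cn r V f \<longleftrightarrow>
     openin (cspace r) V \<and>
     continuous_map (subtopology (cspace r) V) euclidean f \<and>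
     (\<forall>a\<in>V. \<forall>i\<in>{1..r}. (\<lambda>z. f (a(i := z))) field_differentiable (at (a i)))"

text \<open>
  A meromorphic function is represented by a total function whose values on a nowhere dense
  closed set are irrelevant. Two representatives define the same meromorphic function on an
  open set \<open>X\<close> iff they agree on a dense open subset of \<open>X\<close>. All notions below are invariant
  under this equivalence, except that \<open>multL_extension\<close> fixes the values on the domain of the
  series.
\<close>

definition mero_eq ::
    "nat \<Rightarrow> (nat \<Rightarrow> complex) set \<Rightarrow> ((nat \<Rightarrow> complex) \<Rightarrow> complex) \<Rightarrow>
     ((nat \<Rightarrow> complex) \<Rightarrow> complex) \<Rightarrow> bool" where
  "mero_eq r X f g \<longleftrightarrow>
     (\<exists>D. openin (cspace r) D \<and> D \<subseteq> X \<and> X \<subseteq> cspace r closure_of D \<and> (\<forall>z\<in>D. f z = g z))"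

text \<open>
  Locally a quotient \<open>p / q\<close> of holomorphic functions, where \<open>q\<close> does not vanish identically on
  any nonempty open set, i.e. its nonvanishing locus is dense.
\<close>

definition meromorphic_Cn ::
    "nat \<Rightarrow> (nat \<Rightarrow> complex) set \<Rightarrow> ((nat \<Rightarrow> complex) \<Rightarrow> complex) \<Rightarrow> bool" where
  "meromorphic_Cn r X f \<longleftrightarrow>
     openin (cspace r) X \<and>
     (\<forall>a\<in>X. \<exists>V p q. a \<in> V \<and> V \<subseteq> X \<and> holomorphic_Cn r V p \<and> holomorphic_Cn r V q \<and>
        V \<subseteq> cspace r closure_of {z\<in>V. q z \<noteq> 0} \<and>
        mero_eq r V f (\<lambda>z. p z / q z))"

text \<open>
  Outside the finite set \<open>J\<close>, each \<open>h i\<close> is holomorphic on a neighbourhood \<open>V\<close> of \<open>K\<close>, meaning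
  that as a meromorphic function it equals some holomorphic \<open>p i\<close> there; the \<open>p i\<close> supply the
  values entering the suprema.
\<close>

definition normal_tail ::
    "nat \<Rightarrow> (nat \<Rightarrow> complex) set \<Rightarrow> ('i \<Rightarrow> (nat \<Rightarrow> complex) \<Rightarrow> complex) \<Rightarrow> 'i set \<Rightarrow>
     (nat \<Rightarrow> complex) set \<Rightarrow> 'i set \<Rightarrow> ('i \<Rightarrow> (nat \<Rightarrow> complex) \<Rightarrow> complex) \<Rightarrow> bool" where
  "normal_tail r X h I K J p \<longleftrightarrow>
     finite J \<and> J \<subseteq> I \<and>
     (\<forall>i\<in>I - J. \<exists>V. K \<subseteq> V \<and> V \<subseteq> X \<and> holomorphic_Cn r V (p i) \<and> mero_eq r V (h i) (p i)) \<and>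
     (\<lambda>i. SUP z\<in>K. cmod (p i z)) summable_on (I - J)"

text \<open>The condition \<open>K \<noteq> {}\<close> only avoids the unspecified real supremum of the empty set.\<close>

definition normally_summable ::
    "nat \<Rightarrow> (nat \<Rightarrow> complex) set \<Rightarrow> ('i \<Rightarrow> (nat \<Rightarrow> complex) \<Rightarrow> complex) \<Rightarrow> 'i set \<Rightarrow> bool" where
  "normally_summable r X h I \<longleftrightarrow>
     (\<forall>i\<in>I. meromorphic_Cn r X (h i)) \<and>
     (\<forall>K. compactin (cspace r) K \<and> K \<subseteq> X \<and> K \<noteq> {} \<longrightarrow> (\<exists>J p. normal_tail r X h I K J p))"

text \<open>
  The sum of a normally summable family: on the interior of every compact \<open>K\<close> it is the finite
  sum over \<open>J\<close> plus the normally convergent sum of the remaining, holomorphic, terms.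
\<close>

definition mero_has_sum ::
    "nat \<Rightarrow> (nat \<Rightarrow> complex) set \<Rightarrow> ('i \<Rightarrow> (nat \<Rightarrow> complex) \<Rightarrow> complex) \<Rightarrow> 'i set \<Rightarrow>
     ((nat \<Rightarrow> complex) \<Rightarrow> complex) \<Rightarrow> bool" where
  "mero_has_sum r X h I F \<longleftrightarrow>
     normally_summable r X h I \<and>
     (\<forall>K. compactin (cspace r) K \<and> K \<subseteq> X \<and> K \<noteq> {} \<longrightarrow>
        (\<exists>J p. normal_tail r X h I K J p \<and>
           mero_eq r (cspace r interior_of K) F
             (\<lambda>z. (\<Sum>i\<in>J. h i z) + (\<Sum>\<^sub>\<infinity>i\<in>I - J. p i z))))"

definition additive_character :: "(int \<Rightarrow> complex) \<Rightarrow> bool" where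
  "additive_character h \<longleftrightarrow> (\<forall>n. h n \<noteq> 0) \<and> (\<forall>m n. h (m + n) = h m * h n)"

definition partial_prod :: "(nat \<Rightarrow> int \<Rightarrow> complex) \<Rightarrow> nat \<Rightarrow> int \<Rightarrow> complex" where
  "partial_prod f i = (\<lambda>n. \<Prod>j\<in>{1..i}. f j n)"

definition multL_domain :: "nat \<Rightarrow> (nat \<Rightarrow> complex) set" where
  "multL_domain d = {s \<in> Cn d. \<forall>i\<in>{1..d}. Re (\<Sum>j\<in>{1..i}. s j) > real i}"

definition decreasing_tuples :: "nat \<Rightarrow> (nat \<Rightarrow> nat) set" where
  "decreasing_tuples d =
     {n \<in> {1..d} \<rightarrow>\<^sub>E {0<..}. \<forall>i\<in>{1..d}. \<forall>j\<in>{1..d}. i < j \<longrightarrow> n j < n i}"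

definition multL :: "nat \<Rightarrow> (nat \<Rightarrow> int \<Rightarrow> complex) \<Rightarrow> (nat \<Rightarrow> complex) \<Rightarrow> complex" where
  "multL d h s =
     (\<Sum>\<^sub>\<infinity>n\<in>decreasing_tuples d.
        (\<Prod>i\<in>{1..d}. h i (int (n i))) / (\<Prod>i\<in>{1..d}. of_nat (n i) powr s i))"

definition multL_extension ::
    "nat \<Rightarrow> (nat \<Rightarrow> int \<Rightarrow> complex) \<Rightarrow> ((nat \<Rightarrow> complex) \<Rightarrow> complex) \<Rightarrow> bool" where
  "multL_extension d h F \<longleftrightarrow>
     meromorphic_Cn d (Cn d) F \<and> (\<forall>s\<in>multL_domain d. F s = multL d h s)"

text \<open>\<open>s (s + 1) \<dots> (s + k) / (k + 1)!\<close>, which has \<open>k + 1\<close> factors.\<close>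

definition rising :: "complex \<Rightarrow> nat \<Rightarrow> complex" where
  "rising s k = pochhammer s (Suc k) / fact (Suc k)"

text \<open>\<open>(s\<^sub>1, \<dots>, s\<^sub>r) \<mapsto> (s\<^sub>1 + s\<^sub>2 + c, s\<^sub>3, \<dots>, s\<^sub>r)\<close>\<close>

definition merge_first :: "nat \<Rightarrow> complex \<Rightarrow> (nat \<Rightarrow> complex) \<Rightarrow> nat \<Rightarrow> complex" where
  "merge_first r c s = (\<lambda>i\<in>{1..r - 1}. if i = 1 then s 1 + s 2 + c else s (Suc i))"

end

theory Submission imports Defs begin

text \<open>
  Expanding \<open>(1 - 1/n)\<^bsup>-s\<^esup>\<close> by the binomial series gives
  \<open>\<Sum>\<^sub>k (s)\<^sub>k n\<^bsup>-s-k-1\<^esup> = (n - 1)\<^bsup>-s\<^esup> - n\<^bsup>-s\<^esup>\<close> for \<open>n \<ge> 2\<close>. Inserted for \<open>n = n\<^sub>1\<close> and summed over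
  \<open>n\<^sub>1 > n\<^sub>2\<close>, the right-hand side telescopes if \<open>f\<^sub>1(1) = 1\<close>, and otherwise an index shift reproduces
  \<open>f\<^sub>1(1) - 1\<close> times the series plus its diagonal \<open>n\<^sub>1 = n\<^sub>2\<close>; this proves the identities where the
  series converge. All poles lie on hyperplanes \<open>s\<^sub>1 + \<dots> + s\<^sub>i = i - m\<close> with \<open>m \<ge> 0\<close>, so that multiplication by
  \<open>Q(s) = \<Prod>\<^sub>i 1/\<Gamma>(s\<^sub>1 + \<dots> + s\<^sub>i - i)\<close> should make everything entire. Indeed, the identity expresses
  \<open>Q L\<^sub>r\<close> at \<open>s\<close> through \<open>L\<^bsub>r-1\<^esub>\<close> and the values of \<open>L\<^sub>r\<close> at \<open>s + k e\<^sub>1\<close>, \<open>k \<ge> 1\<close>, and since the latter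
  decay like \<open>2\<^bsup>-k\<^esup>\<close> this recursion continues \<open>Q L\<^sub>r\<close> holomorphically from each translate of the
  domain to the next. The recursion then holds on all of \<open>\<complex>\<^sup>r\<close>, which is the theorem.
\<close>

section \<open>Holomorphic functions on \<open>\<complex>\<^sup>r\<close>\<close>

text \<open>Every partial sum \<open>s 1 + ... + s i\<close> contains \<open>s 1\<close>, so a
  translation in this one variable raises all of them together: each point enters the domain of the
  series after finitely many unit steps, and \<open>Q\<close> changes only by a polynomial factor.
  Solving the identity for the untranslated value is where the two cases differ. For
  \<open>f 1 1 \<noteq> 1\<close> the divisor is the constant \<open>f 1 1 - 1\<close>. For
  \<open>f 1 1 = 1\<close> it is the coefficient \<open>s 1 - 1\<close> of the term
  \<open>k = 0\<close>, which has zeros; but it divides all later coefficients as well, and the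
  factor \<open>i = 1\<close> of \<open>Q\<close> supplies another \<open>s 1 - 1\<close>, so
  nothing singular is left. The lower series can be given the first character
  \<open>f 1 * f 2\<close> in both cases, so one induction on the depth serves both. Since single
  values \<open>f i 1\<close> may exceed \<open>1\<close> in modulus, convergence has to come from
  the partial products alone, through summation by parts.\<close>

lemma Cn_eq: "Cn r = PiE {1..r} (\<lambda>_. UNIV)"
  by (simp add: cspace_def)

lemma Cn_upd: "a \<in> Cn r \<Longrightarrow> i \<in> {1..r} \<Longrightarrow> a(i := z) \<in> Cn r"
  by (auto simp: Cn_eq PiE_iff extensional_def)

text \<open>Identifies the abstract topology with a subspace of the function type, so that
  \<open>open\<close>, \<open>continuous_on\<close> and uniform limits become available for
  functions on \<open>Cn r\<close>.\<close>

lemma cspace_top_of_set: "cspace r = top_of_set (Cn r)"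
proof (rule topology_eq[THEN iffD2], intro allI iffI)
  have "continuous_map (cspace r) (product_topology (\<lambda>_. euclidean) UNIV) (\<lambda>x. x)"
  proof (subst continuous_map_componentwise_UNIV, intro allI)
    fix k :: nat
    show "continuous_map (cspace r) euclidean (\<lambda>x. x k)"
    proof (cases "k \<in> {1..r}")
      case True
      then show ?thesis unfolding cspace_def by (rule continuous_map_product_projection)
    next
      case False
      \<comment> \<open>Off \<open>{1..r}\<close> an extensional function takes the constant value
        \<open>undefined\<close>.\<close>
      show ?thesis
        by (rule continuous_map_eq[where f = "\<lambda>_. undefined"])
           (use False in \<open>auto simp: Cn_eq PiE_iff extensional_def\<close>)
    qed
  qed
  then have *: "continuous_map (cspace r) (top_of_set (Cn r)) (\<lambda>x. x)"
    by (simp add: euclidean_product_topology continuous_map_in_subtopology)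
  fix S
  assume S: "openin (top_of_set (Cn r)) S"
  then have "openin (cspace r) {x \<in> Cn r. x \<in> S}"
    using * by (simp add: continuous_map_def)
  moreover have "{x \<in> Cn r. x \<in> S} = S" using openin_subset[OF S] by auto
  ultimately show "openin (cspace r) S" by simp
next
  have *: "continuous_map (top_of_set (Cn r)) (cspace r) (\<lambda>x. x)"
    unfolding cspace_def
    by (subst continuous_map_componentwise)
       (auto simp: PiE_iff intro!: continuous_on_product_coordinates continuous_on_subset[of UNIV])
  fix S
  assume S: "openin (cspace r) S"
  then have "openin (top_of_set (Cn r)) {x \<in> Cn r. x \<in> S}"
    using * by (simp add: continuous_map_def)
  moreover have "{x \<in> Cn r. x \<in> S} = S" using openin_subset[OF S] by auto
  ultimately show "openin (top_of_set (Cn r)) S" by simp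
qed

lemma openin_cspace_iff: "openin (cspace r) V \<longleftrightarrow> (\<exists>T. open T \<and> V = Cn r \<inter> T)"
  by (subst cspace_top_of_set) (simp add: openin_open)

lemma holomorphic_Cn_iff:
  "holomorphic_Cn r V f \<longleftrightarrow> openin (cspace r) V \<and> continuous_on V f \<and>
     (\<forall>a\<in>V. \<forall>i\<in>{1..r}. (\<lambda>z. f (a(i := z))) field_differentiable (at (a i)))"
proof -
  have "subtopology (cspace r) V = top_of_set V" if "openin (cspace r) V"
    using openin_subset[OF that]
    by (subst cspace_top_of_set) (simp add: subtopology_subtopology Int_absorb1)
  then show ?thesis
    unfolding holomorphic_Cn_def by auto
qed

lemma openin_cspace_Collect_less:
  assumes "continuous_on UNIV f" "continuous_on UNIV g"
  shows "openin (cspace r) {s \<in> Cn r. f s < (g s :: real)}"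
proof -
  have "{s \<in> Cn r. f s < g s} = Cn r \<inter> {s. f s < g s}" by auto
  then show ?thesis
    using open_Collect_less[OF assms] by (auto simp: openin_cspace_iff)
qed

lemma openin_cspace_Collect_ball_less:
  assumes "finite I" "\<And>i. i \<in> I \<Longrightarrow> continuous_on UNIV (f i)" "\<And>i. i \<in> I \<Longrightarrow> continuous_on UNIV (g i)"
  shows "openin (cspace r) {s \<in> Cn r. \<forall>i\<in>I. f i s < (g i s :: real)}"
  using assms
proof (induction I rule: finite_induct)
  case (insert i I)
  have "{s \<in> Cn r. \<forall>i\<in>insert i I. f i s < g i s} =
      {s \<in> Cn r. f i s < g i s} \<inter> {s \<in> Cn r. \<forall>i\<in>I. f i s < g i s}"
    by auto
  then show ?case
    using insert openin_cspace_Collect_less[of "f i" "g i" r] by (auto intro!: openin_Int)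
qed auto

lemma continuous_on_upd [continuous_intros]:
  fixes f :: "'a::topological_space \<Rightarrow> nat \<Rightarrow> complex"
  assumes "continuous_on S f" "continuous_on S g"
  shows "continuous_on S (\<lambda>x. (f x)(i := g x))"
proof (rule continuous_on_coordinatewise_then_product)
  fix j
  show "continuous_on S (\<lambda>x. ((f x)(i := g x)) j)"
    using assms by (cases "j = i") (auto intro: continuous_on_product_then_coordinatewise)
qed

lemma holomorphic_Cn_open: "holomorphic_Cn r V f \<Longrightarrow> openin (cspace r) V"
  by (simp add: holomorphic_Cn_def)

lemma holomorphic_Cn_subset:
  assumes "holomorphic_Cn r V f" "openin (cspace r) W" "W \<subseteq> V"
  shows "holomorphic_Cn r W f"
  using assms unfolding holomorphic_Cn_iff by (auto intro: continuous_on_subset)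

lemma open_upd_slice:
  assumes "openin (cspace r) V" "a \<in> V" "i \<in> {1..r}"
  shows "open {z. a(i := z) \<in> V}"
proof -
  obtain T where T: "open T" "V = Cn r \<inter> T"
    using assms(1) by (auto simp: openin_cspace_iff)
  have a: "a(i := z) \<in> Cn r" for z
    using assms T by (auto intro: Cn_upd)
  have "open ((\<lambda>z. a(i := z)) -` T)"
    by (rule open_vimage[OF T(1)]) (intro continuous_intros)
  also have "(\<lambda>z. a(i := z)) -` T = {z. a(i := z) \<in> V}"
    using a T by auto
  finally show ?thesis .
qed

lemma holomorphic_Cn_cong:
  assumes "holomorphic_Cn r V f" "\<And>s. s \<in> V \<Longrightarrow> f s = g s"
  shows "holomorphic_Cn r V g"
proof -
  have "(\<lambda>z. g (a(i := z))) field_differentiable (at (a i))" if a: "a \<in> V" "i \<in> {1..r}" for a i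
  proof -
    have V: "openin (cspace r) V" using assms holomorphic_Cn_open by blast
    have "(\<lambda>z. f (a(i := z))) field_differentiable (at (a i))"
      using assms a by (auto simp: holomorphic_Cn_def)
    then obtain D where D: "((\<lambda>z. f (a(i := z))) has_field_derivative D) (at (a i))"
      by (auto simp: field_differentiable_def)
    have "((\<lambda>z. g (a(i := z))) has_field_derivative D) (at (a i))"
      by (rule has_field_derivative_transform_within_open[OF D open_upd_slice[OF V a]])
         (use assms a in auto)
    then show ?thesis by (auto simp: field_differentiable_def)
  qed
  then show ?thesis
    using assms unfolding holomorphic_Cn_iff by (auto cong: continuous_on_cong)
qed

text \<open>Majorants and margins exist only near a given point, so later holomorphy proofs are
  localized by this lemma. Continuity passes from \<open>W\<close> to \<open>V\<close> because
  \<open>W\<close> is relatively open, so both filters at \<open>a\<close> agree.\<close>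

lemma holomorphic_Cn_local:
  assumes "\<And>a. a \<in> V \<Longrightarrow> \<exists>W. a \<in> W \<and> W \<subseteq> V \<and> holomorphic_Cn r W f"
  shows "holomorphic_Cn r V f"
proof -
  obtain W where W: "\<And>a. a \<in> V \<Longrightarrow> a \<in> W a \<and> W a \<subseteq> V \<and> holomorphic_Cn r (W a) f"
    using assms by metis
  have V: "V = (\<Union>a\<in>V. W a)" using W by blast
  have o: "openin (cspace r) V"
    using W by (subst V) (auto intro!: openin_clauses(3) simp: holomorphic_Cn_def)
  have "continuous_on V f"
  proof (subst continuous_on_eq_continuous_within, intro ballI)
    fix a assume a: "a \<in> V"
    have c: "continuous (at a within W a) f"
      using W[OF a] by (auto simp: holomorphic_Cn_iff continuous_on_eq_continuous_within)
    obtain T where T: "open T" "W a = Cn r \<inter> T"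
      using W[OF a] by (auto simp: holomorphic_Cn_iff openin_cspace_iff)
    have "V \<subseteq> Cn r" using openin_subset[OF o] .
    then have "V \<inter> T = W a \<inter> T" using W[OF a] T by auto
    then have "at a within V = at a within W a"
      using T(1) W[OF a] T(2) by (intro at_within_nhd[of a T]) auto
    then show "continuous (at a within V) f" using c by simp
  qed
  then show ?thesis
    using W o unfolding holomorphic_Cn_iff by blast
qed

lemma holomorphic_Cn_const: "openin (cspace r) V \<Longrightarrow> holomorphic_Cn r V (\<lambda>_. c)"
  by (auto simp: holomorphic_Cn_iff)

lemma holomorphic_Cn_add:
  "holomorphic_Cn r V f \<Longrightarrow> holomorphic_Cn r V g \<Longrightarrow> holomorphic_Cn r V (\<lambda>s. f s + g s)"
  by (auto simp: holomorphic_Cn_iff intro!: continuous_intros field_differentiable_add)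

lemma holomorphic_Cn_mult:
  "holomorphic_Cn r V f \<Longrightarrow> holomorphic_Cn r V g \<Longrightarrow> holomorphic_Cn r V (\<lambda>s. f s * g s)"
  by (auto simp: holomorphic_Cn_iff intro!: continuous_intros field_differentiable_mult)

lemma holomorphic_Cn_divide:
  assumes "holomorphic_Cn r V f" "holomorphic_Cn r V g" "\<And>s. s \<in> V \<Longrightarrow> g s \<noteq> 0"
  shows "holomorphic_Cn r V (\<lambda>s. f s / g s)"
  using assms
  by (auto simp: holomorphic_Cn_iff intro!: continuous_intros field_differentiable_divide)

lemma holomorphic_Cn_sum:
  assumes "openin (cspace r) V" "\<And>i. i \<in> I \<Longrightarrow> holomorphic_Cn r V (f i)"
  shows "holomorphic_Cn r V (\<lambda>s. \<Sum>i\<in>I. f i s)"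
  using assms(2)
  by (induction I rule: infinite_finite_induct)
     (auto intro: holomorphic_Cn_add holomorphic_Cn_const assms(1))

lemma holomorphic_Cn_prod:
  assumes "openin (cspace r) V" "\<And>i. i \<in> I \<Longrightarrow> holomorphic_Cn r V (f i)"
  shows "holomorphic_Cn r V (\<lambda>s. \<Prod>i\<in>I. f i s)"
  using assms(2)
  by (induction I rule: infinite_finite_induct)
     (auto intro: holomorphic_Cn_mult holomorphic_Cn_const assms(1))

lemma holomorphic_Cn_coord:
  assumes "openin (cspace r) V"
  shows "holomorphic_Cn r V (\<lambda>s. s j)"
proof -
  have "(\<lambda>z. (a(i := z)) j) field_differentiable (at (a i))" for a :: "nat \<Rightarrow> complex" and i
    by (cases "j = i") (auto simp: field_differentiable_ident field_differentiable_const)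
  moreover have "continuous_on V (\<lambda>s. s j :: complex)"
    by (rule continuous_on_subset[OF continuous_on_product_coordinates]) auto
  ultimately show ?thesis
    using assms by (auto simp: holomorphic_Cn_iff)
qed

lemma holomorphic_Cn_compose1:
  assumes "holomorphic_Cn r V f" "g holomorphic_on UNIV"
  shows "holomorphic_Cn r V (\<lambda>s. g (f s))"
  unfolding holomorphic_Cn_iff
proof (intro conjI ballI)
  show "continuous_on V (\<lambda>s. g (f s))"
    using assms holomorphic_on_imp_continuous_on[OF assms(2)]
    by (auto simp: holomorphic_Cn_iff intro: continuous_on_compose2[of UNIV g])
  show "(\<lambda>z. g (f (a(i := z)))) field_differentiable (at (a i))" if "a \<in> V" "i \<in> {1..r}" for a i
  proof -
    have "(g \<circ> (\<lambda>z. f (a(i := z)))) field_differentiable (at (a i))"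
      using assms that
      by (intro field_differentiable_compose)
         (auto simp: holomorphic_Cn_iff holomorphic_on_def)
    then show ?thesis by (simp add: o_def)
  qed
qed (use assms in \<open>auto simp: holomorphic_Cn_iff\<close>)

text \<open>Moving one coordinate of the argument merely translates one coordinate of
  \<open>\<phi>\<close>, so differentiability in each variable transfers without a chain rule in
  several variables. This covers translations as well as the merging map, where \<open>s 1\<close>
  and \<open>s 2\<close> both move coordinate \<open>1\<close>.\<close>

lemma holomorphic_Cn_compose:
  assumes f: "holomorphic_Cn d W f" and V: "openin (cspace r) V"
    and \<phi>: "continuous_on V \<phi>" "\<And>s. s \<in> V \<Longrightarrow> \<phi> s \<in> W"
    and \<phi>1: "\<And>a i. a \<in> V \<Longrightarrow> i \<in> {1..r} \<Longrightarrow>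
      \<exists>j\<in>{1..d}. \<exists>c. \<forall>z. \<phi> (a(i := z)) = (\<phi> a)(j := z + c)"
  shows "holomorphic_Cn r V (\<lambda>s. f (\<phi> s))"
  unfolding holomorphic_Cn_iff
proof (intro conjI ballI)
  show "continuous_on V (\<lambda>s. f (\<phi> s))"
    using f \<phi> by (auto simp: holomorphic_Cn_iff intro: continuous_on_compose2[of W f])
  show "(\<lambda>z. f (\<phi> (a(i := z)))) field_differentiable (at (a i))" if ai: "a \<in> V" "i \<in> {1..r}" for a i
  proof -
    obtain j c where j: "j \<in> {1..d}" and eq: "\<And>z. \<phi> (a(i := z)) = (\<phi> a)(j := z + c)"
      using \<phi>1[OF ai] by blast
    have "\<phi> a = (\<phi> a)(j := a i + c)" using eq[of "a i"] by simp
    then have aj: "\<phi> a j = a i + c" by (metis fun_upd_same)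
    have "((\<lambda>z. f ((\<phi> a)(j := z))) \<circ> (\<lambda>z. z + c)) field_differentiable (at (a i))"
      using f j \<phi>(2)[OF ai(1)]
      by (intro field_differentiable_compose field_differentiable_add
            field_differentiable_ident field_differentiable_const)
         (auto simp: holomorphic_Cn_iff aj[symmetric])
    then show ?thesis by (simp add: o_def eq)
  qed
qed (use V in \<open>auto\<close>)

text \<open>The majorant makes the finite partial sums converge uniformly on \<open>V\<close>, which
  gives continuity. Differentiability in one variable is the uniform limit theorem for holomorphic
  functions on a closed disc inside a slice, where the other coordinates are frozen.\<close>

lemma holomorphic_Cn_infsum:
  assumes V: "openin (cspace r) V"
    and f: "\<And>n. n \<in> I \<Longrightarrow> holomorphic_Cn r V (f n)"
    and le: "\<And>n s. n \<in> I \<Longrightarrow> s \<in> V \<Longrightarrow> cmod (f n s) \<le> M n"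
    and M: "M summable_on I"
  shows "holomorphic_Cn r V (\<lambda>s. \<Sum>\<^sub>\<infinity>n\<in>I. f n s)"
  unfolding holomorphic_Cn_iff
proof (intro conjI ballI)
  have lim: "uniform_limit V (\<lambda>X s. \<Sum>n\<in>X. f n s) (\<lambda>s. \<Sum>\<^sub>\<infinity>n\<in>I. f n s) (finite_subsets_at_top I)"
    by (rule Weierstrass_m_test_general[OF le M])
  have hX: "\<forall>\<^sub>F X in finite_subsets_at_top I. holomorphic_Cn r V (\<lambda>s. \<Sum>n\<in>X. f n s)"
    by (rule eventually_finite_subsets_at_top_weakI) (use f V in \<open>auto intro!: holomorphic_Cn_sum\<close>)
  show "continuous_on V (\<lambda>s. \<Sum>\<^sub>\<infinity>n\<in>I. f n s)"
    by (rule uniform_limit_theorem[OF _ lim])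
       (use hX in \<open>auto simp: holomorphic_Cn_iff elim: eventually_mono\<close>)
  fix a i
  assume ai: "a \<in> V" "i \<in> {1..r}"
  define W where "W = {z. a(i := z) \<in> V}"
  have W: "open W" "a i \<in> W"
    using open_upd_slice[OF V ai] ai by (auto simp: W_def)
  obtain e where e: "e > 0" "cball (a i) e \<subseteq> W"
    using W open_contains_cball by blast
  have "(\<lambda>z. \<Sum>\<^sub>\<infinity>n\<in>I. f n (a(i := z))) holomorphic_on ball (a i) e"
  proof (rule holomorphic_uniform_limit)
    show "uniform_limit (cball (a i) e) (\<lambda>X z. \<Sum>n\<in>X. f n (a(i := z)))
        (\<lambda>z. \<Sum>\<^sub>\<infinity>n\<in>I. f n (a(i := z))) (finite_subsets_at_top I)"
      by (rule Weierstrass_m_test_general[OF _ M]) (use e le in \<open>auto simp: W_def\<close>)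
    show "\<forall>\<^sub>F X in finite_subsets_at_top I.
       continuous_on (cball (a i) e) (\<lambda>z. \<Sum>n\<in>X. f n (a(i := z))) \<and>
       (\<lambda>z. \<Sum>n\<in>X. f n (a(i := z))) holomorphic_on ball (a i) e"
      using hX
    proof eventually_elim
      case (elim X)
      have "(\<lambda>z. \<Sum>n\<in>X. f n (a(i := z))) field_differentiable (at w)" if "w \<in> cball (a i) e" for w
      proof -
        have "a(i := w) \<in> V" using that e by (auto simp: W_def)
        then have "(\<lambda>z. \<Sum>n\<in>X. f n ((a(i := w))(i := z))) field_differentiable (at ((a(i := w)) i))"
          using elim ai unfolding holomorphic_Cn_iff by blast
        then show ?thesis by simp
      qed
      then have "(\<lambda>z. \<Sum>n\<in>X. f n (a(i := z))) holomorphic_on cball (a i) e"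
        by (auto simp: holomorphic_on_def intro: field_differentiable_at_within)
      then show ?case
        using holomorphic_on_imp_continuous_on holomorphic_on_subset ball_subset_cball by blast
    qed
  qed auto
  then show "(\<lambda>z. \<Sum>\<^sub>\<infinity>n\<in>I. f n (a(i := z))) field_differentiable (at (a i))"
    by (rule holomorphic_on_imp_differentiable_at) (use e in auto)
qed (use V in \<open>auto\<close>)

section \<open>Translation in the first variable\<close>

definition shift_first :: "nat \<Rightarrow> (nat \<Rightarrow> complex) \<Rightarrow> nat \<Rightarrow> complex" where
  "shift_first k s = s(1 := s 1 + of_nat k)"

definition gamma_factor :: "nat \<Rightarrow> (nat \<Rightarrow> complex) \<Rightarrow> complex" where
  "gamma_factor r s = (\<Prod>i\<in>{1..r}. rGamma ((\<Sum>j\<in>{1..i}. s j) - of_nat i))"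

text \<open>Open polydiscs around the origin stand in for compact sets: bounds uniform on each of
  them suffice for holomorphy near a point and for normal convergence.\<close>

definition coord_box :: "nat \<Rightarrow> real \<Rightarrow> (nat \<Rightarrow> complex) set" where
  "coord_box r R = {s \<in> Cn r. \<forall>i\<in>{1..r}. cmod (s i) < R}"

lemma shift_first_Cn: "s \<in> Cn r \<Longrightarrow> 1 \<le> r \<Longrightarrow> shift_first k s \<in> Cn r"
  unfolding shift_first_def by (rule Cn_upd) auto

lemma shift_first_0 [simp]: "shift_first 0 s = s"
  by (simp add: shift_first_def)

lemma shift_first_add: "shift_first k (shift_first l s) = shift_first (k + l) s"
  by (simp add: shift_first_def add_ac)

lemma sum_upd_first:
  fixes s :: "nat \<Rightarrow> complex"
  assumes "1 \<le> i"
  shows "(\<Sum>j\<in>{1..i}. (s(1 := z)) j) = (\<Sum>j\<in>{1..i}. s j) - s 1 + z"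
proof -
  have "{1..i} = insert 1 {2..i}" using assms by auto
  then show ?thesis by simp
qed

lemma sum_shift_first:
  "1 \<le> i \<Longrightarrow> (\<Sum>j\<in>{1..i}. shift_first k s j) = (\<Sum>j\<in>{1..i}. s j) + of_nat k"
  unfolding shift_first_def by (subst sum_upd_first) simp_all

lemma multL_domain_subset: "multL_domain r \<subseteq> Cn r"
  by (auto simp: multL_domain_def)

lemma continuous_on_partial_sum [continuous_intros]:
  "continuous_on A (\<lambda>s. \<Sum>j\<in>I. s j :: complex)"
  by (intro continuous_intros continuous_on_subset[OF continuous_on_product_coordinates]) auto

lemma openin_partial_sums_gt:
  "openin (cspace r) {s \<in> Cn r. \<forall>i\<in>{1..r}. x i < Re (\<Sum>j\<in>{1..i}. s j)}"
  by (rule openin_cspace_Collect_ball_less) (auto intro!: continuous_intros simp del: Re_sum)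

lemma openin_multL_domain: "openin (cspace r) (multL_domain r)"
  using openin_partial_sums_gt[of r real] by (simp add: multL_domain_def)

lemma openin_coord_box: "openin (cspace r) (coord_box r R)"
  unfolding coord_box_def
  by (rule openin_cspace_Collect_ball_less)
     (auto intro!: continuous_intros continuous_on_product_coordinates)

lemma in_coord_box:
  assumes "s \<in> Cn r"
  shows "\<exists>R>0. s \<in> coord_box r R"
proof (intro exI conjI)
  show "(\<Sum>i\<in>{1..r}. cmod (s i)) + 1 > 0" by (simp add: add_nonneg_pos sum_nonneg)
  show "s \<in> coord_box r ((\<Sum>i\<in>{1..r}. cmod (s i)) + 1)"
    using assms by (auto simp: coord_box_def intro!: le_less_trans[OF member_le_sum[of _ _ "\<lambda>i. cmod (s i)"]])
qed

lemma compact_subset_coord_box: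
  assumes "compactin (cspace r) K"
  shows "\<exists>R>0. K \<subseteq> coord_box r R"
proof -
  have mono: "coord_box r R \<subseteq> coord_box r S" if "R \<le> S" for R S
    using that by (auto simp: coord_box_def)
  have "\<exists>\<F>. finite \<F> \<and> \<F> \<subseteq> range (\<lambda>n::nat. coord_box r (real n)) \<and> K \<subseteq> \<Union>\<F>"
  proof (rule compactinD[OF assms])
    show "K \<subseteq> \<Union>(range (\<lambda>n::nat. coord_box r (real n)))"
    proof
      fix s assume "s \<in> K"
      then have "s \<in> Cn r" using compactin_subset_topspace[OF assms] by auto
      then obtain R where "s \<in> coord_box r R" using in_coord_box by blast
      then show "s \<in> \<Union>(range (\<lambda>n::nat. coord_box r (real n)))"
        using mono[of R "real (nat \<lceil>R\<rceil>)"] by (auto intro: real_nat_ceiling_ge)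
    qed
  qed (auto intro: openin_coord_box)
  then obtain \<F> where \<F>: "finite \<F>" "\<F> \<subseteq> range (\<lambda>n::nat. coord_box r (real n))" "K \<subseteq> \<Union>\<F>"
    by blast
  obtain N where "finite N" "\<F> = (\<lambda>n::nat. coord_box r (real n)) ` N"
    using finite_subset_image[OF \<F>(1,2)] by blast
  then have N: "finite N" "K \<subseteq> (\<Union>n\<in>N. coord_box r (real n))" using \<F>(3) by auto
  \<comment> \<open>The cover is nested, so the largest radius suffices. \<open>insert 0\<close>
    keeps \<open>Max\<close> defined when \<open>N\<close> is empty, and \<open>Suc\<close> makes
    the radius positive.\<close>
  have "K \<subseteq> coord_box r (real (Suc (Max (insert 0 N))))"
  proof
    fix s assume "s \<in> K"
    then obtain n where n: "n \<in> N" "s \<in> coord_box r (real n)" using N by auto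
    then have "n \<le> Max (insert 0 N)" using N by auto
    then show "s \<in> coord_box r (real (Suc (Max (insert 0 N))))"
      using mono[of "real n" "real (Suc (Max (insert 0 N)))"] n by auto
  qed
  then show ?thesis by (intro exI[of _ "real (Suc (Max (insert 0 N)))"]) auto
qed

lemma shift_first_upd:
  assumes "i \<in> {1..r}"
  shows "\<exists>j\<in>{1..r}. \<exists>c. \<forall>z. shift_first k (a(i := z)) = (shift_first k a)(j := z + c)"
proof (cases "i = 1")
  case True
  then show ?thesis
    using assms by (intro bexI[of _ 1] exI[of _ "of_nat k"]) (auto simp: shift_first_def)
next
  case False
  then show ?thesis
    using assms by (intro bexI[of _ i] exI[of _ 0]) (auto simp: shift_first_def fun_upd_twist)
qed

lemma continuous_on_shift_first [continuous_intros]: "continuous_on V (shift_first k)"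
  unfolding shift_first_def[abs_def]
  by (intro continuous_intros continuous_on_subset[OF continuous_on_product_coordinates]
        continuous_on_id) auto

lemma holomorphic_Cn_shift_first:
  assumes "holomorphic_Cn r W f" "openin (cspace r) V" "\<And>s. s \<in> V \<Longrightarrow> shift_first k s \<in> W"
  shows "holomorphic_Cn r V (\<lambda>s. f (shift_first k s))"
  by (rule holomorphic_Cn_compose[OF assms(1,2)])
     (use assms shift_first_upd in \<open>auto intro: continuous_intros\<close>)

lemma holomorphic_Cn_partial_sum:
  assumes "openin (cspace r) V"
  shows "holomorphic_Cn r V (\<lambda>s. (\<Sum>j\<in>I. s j) + c)"
  by (intro holomorphic_Cn_add holomorphic_Cn_sum holomorphic_Cn_coord holomorphic_Cn_const assms)

section \<open>The entire factor that clears the poles\<close>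

lemma holomorphic_Cn_gamma_factor: "holomorphic_Cn r (Cn r) (gamma_factor r)"
proof -
  have "holomorphic_Cn r (Cn r) (\<lambda>s. rGamma ((\<Sum>j\<in>{1..i}. s j) + - of_nat i))" for i
    by (rule holomorphic_Cn_compose1[OF holomorphic_Cn_partial_sum holomorphic_rGamma]) auto
  then show ?thesis
    unfolding gamma_factor_def[abs_def] by (intro holomorphic_Cn_prod) auto
qed

lemma gamma_factor_nonzero:
  assumes "s \<in> multL_domain r"
  shows "gamma_factor r s \<noteq> 0"
proof -
  have "(\<Sum>j\<in>{1..i}. s j) - of_nat i \<notin> \<int>\<^sub>\<le>\<^sub>0" if "i \<in> {1..r}" for i
  proof
    assume "(\<Sum>j\<in>{1..i}. s j) - of_nat i \<in> \<int>\<^sub>\<le>\<^sub>0"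
    then obtain n :: int where "(\<Sum>j\<in>{1..i}. s j) - of_nat i = of_int n" "n \<le> 0"
      by (elim nonpos_Ints_cases)
    then have "Re ((\<Sum>j\<in>{1..i}. s j) - of_nat i) \<le> 0" by simp
    moreover have "Re (\<Sum>j\<in>{1..i}. s j) > real i"
      using assms that by (auto simp: multL_domain_def simp del: Re_sum)
    ultimately show False by (simp del: Re_sum)
  qed
  then show ?thesis by (auto simp: gamma_factor_def rGamma_eq_zero_iff)
qed

text \<open>Along the first coordinate the zeros of the gamma factor are countable.\<close>

lemma gamma_factor_dense:
  assumes V: "openin (cspace r) V" and r: "1 \<le> r"
  shows "V \<subseteq> cspace r closure_of {s \<in> V. gamma_factor r s \<noteq> 0}"
proof
  fix s assume s: "s \<in> V"
  show "s \<in> cspace r closure_of {s \<in> V. gamma_factor r s \<noteq> 0}"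
    unfolding in_closure_of
  proof (intro conjI allI impI)
    show "s \<in> Cn r" using openin_subset[OF V] s by auto
    fix T assume T: "s \<in> T \<and> openin (cspace r) T"
    define W where "W = {z. s(1 := z) \<in> V \<inter> T}"
    have "openin (cspace r) (V \<inter> T)" using V T by auto
    then have W: "open W" "s 1 \<in> W"
      using open_upd_slice[of r "V \<inter> T" s 1] s T r by (auto simp: W_def)
    then obtain e where e: "e > 0" "ball (s 1) e \<subseteq> W"
      by (meson open_contains_ball)
    define Z where "Z = (\<Union>i\<in>{1..r}. range (\<lambda>n::nat. of_nat i - ((\<Sum>j\<in>{1..i}. s j) - s 1) - of_nat n))"
    have "countable Z" unfolding Z_def by auto
    then have "\<not> ball (s 1) e \<subseteq> Z"
      using uncountable_ball[OF e(1), of "s 1"] countable_subset by blast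
    then obtain z where z: "z \<in> W" "z \<notin> Z" using e by blast
    have "gamma_factor r (s(1 := z)) \<noteq> 0"
    proof
      assume "gamma_factor r (s(1 := z)) = 0"
      then obtain i where i: "i \<in> {1..r}"
        "rGamma ((\<Sum>j\<in>{1..i}. (s(1 := z)) j) - of_nat i) = 0"
        unfolding gamma_factor_def by auto
      then obtain n :: nat where "(\<Sum>j\<in>{1..i}. s j) - s 1 + z - of_nat i = - of_nat n"
        using sum_upd_first[of i s z] by (auto simp: rGamma_eq_zero_iff elim!: nonpos_Ints_cases')
      then have "z = of_nat i - ((\<Sum>j\<in>{1..i}. s j) - s 1) - of_nat n" by (simp add: algebra_simps)
      then show False using z(2) i(1) unfolding Z_def by blast
    qed
    then show "\<exists>y. y \<in> {s \<in> V. gamma_factor r s \<noteq> 0} \<and> y \<in> T"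
      using z by (auto simp: W_def)
  qed
qed

text \<open>A translation adds \<open>1\<close> to every partial sum, so
  \<open>rGamma w = w * rGamma (w + 1)\<close> applies to each factor. The product of linear forms
  is the polynomial by which \<open>Q\<close> changes in the recursion.\<close>

lemma gamma_factor_shift_1:
  "gamma_factor r s =
    (\<Prod>i\<in>{1..r}. (\<Sum>j\<in>{1..i}. s j) + - of_nat i) * gamma_factor r (shift_first 1 s)"
proof -
  have "gamma_factor r (shift_first 1 s) = (\<Prod>i\<in>{1..r}. rGamma ((\<Sum>j\<in>{1..i}. s j) - of_nat i + 1))"
    unfolding gamma_factor_def by (intro prod.cong refl) (subst sum_shift_first, auto simp: algebra_simps)
  then show ?thesis
    by (simp add: prod.distrib[symmetric] rGamma_plus1 gamma_factor_def)
qed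

lemma openin_gamma_factor_nonzero:
  "openin (cspace r) V \<Longrightarrow> openin (cspace r) {s \<in> V. gamma_factor r s \<noteq> 0}"
proof -
  assume V: "openin (cspace r) V"
  have "continuous_map (cspace r) euclidean (gamma_factor r)"
    using holomorphic_Cn_gamma_factor[of r] by (simp add: holomorphic_Cn_def)
  moreover have "openin euclidean (- {0 :: complex})"
    by (rule open_openin[THEN iffD1]) auto
  ultimately have "openin (cspace r) {s \<in> Cn r. gamma_factor r s \<in> - {0}}"
    by (rule openin_continuous_map_preimage)
  then have "openin (cspace r) (V \<inter> {s \<in> Cn r. gamma_factor r s \<in> - {0}})"
    using V by auto
  also have "V \<inter> {s \<in> Cn r. gamma_factor r s \<in> - {0}} = {s \<in> V. gamma_factor r s \<noteq> 0}"
    using openin_subset[OF V] by auto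
  finally show ?thesis .
qed

lemma openin_shift_first_vimage:
  assumes "openin (cspace r) W" "1 \<le> r"
  shows "openin (cspace r) {s \<in> Cn r. shift_first m s \<in> W}"
proof -
  obtain T where T: "open T" "W = Cn r \<inter> T" using assms by (auto simp: openin_cspace_iff)
  have "{s \<in> Cn r. shift_first m s \<in> W} = Cn r \<inter> (shift_first m -` T)"
    using T shift_first_Cn assms(2) by auto
  then show ?thesis
    using open_vimage[OF T(1), of "shift_first m"] continuous_on_shift_first
    by (auto simp: openin_cspace_iff)
qed

section \<open>Reaching the domain of convergence by translation\<close>

lemma shift_first_multL_domain:
  assumes s: "s \<in> multL_domain r" and r: "1 \<le> r"
  shows "shift_first k s \<in> multL_domain r"
proof -
  have "real i < Re (\<Sum>j\<in>{1..i}. s j) + real k" if "i \<in> {1..r}" for i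
    using that s by (force simp: multL_domain_def simp del: Re_sum)
  then have "real i < Re (\<Sum>j\<in>{1..i}. shift_first k s j)" if "i \<in> {1..r}" for i
    using that by (subst sum_shift_first) (auto simp del: Re_sum)
  then show ?thesis
    using s shift_first_Cn[OF _ r, of s k] unfolding multL_domain_def by blast
qed

text \<open>On the box every partial sum has real part at least \<open>- r * R\<close>, which fixes
  a number of steps that suffices uniformly. The surplus \<open>c\<close> per index turns the strict
  inequalities of the domain into a margin; it becomes the \<open>\<delta>\<close> of the term
  estimates.\<close>

lemma coord_box_shift_multL_domain:
  assumes "s \<in> coord_box r R" "1 \<le> r" "real k \<ge> real r * (R + c + 1)" "R \<ge> 0" "c \<ge> 0" "i \<in> {1..r}"
  shows "Re (\<Sum>j\<in>{1..i}. shift_first k s j) \<ge> real i * (1 + c)"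
proof -
  have "- (real r * R) \<le> - (real i * R)" using assms by (simp add: mult_right_mono)
  also have "\<dots> = (\<Sum>j\<in>{1..i}. - R)" by simp
  also have "\<dots> \<le> (\<Sum>j\<in>{1..i}. Re (s j))"
  proof (rule sum_mono)
    fix j assume "j \<in> {1..i}"
    then have "cmod (s j) < R" using assms by (auto simp: coord_box_def)
    then show "- R \<le> Re (s j)" using abs_Re_le_cmod[of "s j"] by linarith
  qed
  finally have "- (real r * R) \<le> Re (\<Sum>j\<in>{1..i}. s j)" by simp
  moreover have "real i * (1 + c) \<le> real r * (1 + c)" using assms by (intro mult_right_mono) auto
  moreover have "real r * (R + c + 1) = real r * R + real r * (1 + c)" by (simp add: algebra_simps)
  moreover have "Re (\<Sum>j\<in>{1..i}. shift_first k s j) = Re (\<Sum>j\<in>{1..i}. s j) + real k"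
    using assms by (subst sum_shift_first) (auto simp del: Re_sum)
  ultimately show ?thesis
    using assms(3) by linarith
qed

lemma shift_first_in_multL_domain_ex:
  assumes "s \<in> Cn r" "1 \<le> r"
  shows "\<exists>m. shift_first m s \<in> multL_domain r"
proof -
  obtain R where R: "R > 0" "s \<in> coord_box r R" using in_coord_box[OF assms(1)] by blast
  obtain m :: nat where m: "real m \<ge> real r * (R + 1 + 1)" using real_arch_simple by blast
  have "real i < Re (\<Sum>j\<in>{1..i}. shift_first m s j)" if "i \<in> {1..r}" for i
    using coord_box_shift_multL_domain[OF R(2) assms(2) m, of i] R that by (auto simp del: Re_sum)
  then show ?thesis
    using shift_first_Cn[OF assms, of m] unfolding multL_domain_def by blast
qed

text \<open>
  In the proof, \<open>E m\<close> iterates the right-hand side of \<open>rec\<close>, with \<open>Q s\<close> split as \<open>cc k s\<close> times the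
  value of \<open>Q\<close> at the translated point; it is holomorphic on the \<open>m\<close>-fold translate of the domain.
  As \<open>E (m + 1)\<close> agrees with \<open>E m\<close> there, no identity theorem is needed to glue.
\<close>

lemma translation_continuation:
  fixes A Q c L :: "(nat \<Rightarrow> complex) \<Rightarrow> complex" and b :: "nat \<Rightarrow> (nat \<Rightarrow> complex) \<Rightarrow> complex"
  assumes r: "1 \<le> r"
    and L: "holomorphic_Cn r (multL_domain r) L"
    and Q: "holomorphic_Cn r (Cn r) Q" and c: "holomorphic_Cn r (Cn r) c"
    and A: "holomorphic_Cn r (Cn r) A" and b: "\<And>k. holomorphic_Cn r (Cn r) (b k)"
    and Qc: "\<And>s. s \<in> Cn r \<Longrightarrow> Q s = c s * Q (shift_first 1 s)"
    and decay: "\<And>R. R > 0 \<Longrightarrow> \<exists>N g. g summable_on UNIV \<and> (\<forall>s\<in>coord_box r R. \<forall>k\<ge>N.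
        shift_first (Suc k) s \<in> multL_domain r \<and> cmod (b k s * L (shift_first (Suc k) s)) \<le> g k)"
    and rec: "\<And>s. s \<in> multL_domain r \<Longrightarrow>
        Q s * L s = A s + (\<Sum>\<^sub>\<infinity>k. b k s * (Q s * L (shift_first (Suc k) s)))"
  shows "\<exists>H. holomorphic_Cn r (Cn r) H \<and> (\<forall>s\<in>multL_domain r. H s = Q s * L s) \<and>
    (\<forall>s\<in>Cn r. Q s \<noteq> 0 \<longrightarrow>
       H s / Q s = A s / Q s + (\<Sum>\<^sub>\<infinity>k. b k s * (H (shift_first (Suc k) s) / Q (shift_first (Suc k) s))))"
proof -
  let ?U = "multL_domain r"
  define cc where "cc = (\<lambda>k s. \<Prod>j<k. c (shift_first j s))"
  define E where "E = rec_nat (\<lambda>s. Q s * L s)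
    (\<lambda>_ h s. A s + (\<Sum>\<^sub>\<infinity>k. b k s * (cc (Suc k) s * h (shift_first (Suc k) s))))"
  have E0: "E 0 = (\<lambda>s. Q s * L s)" by (simp add: E_def)
  have ES: "E (Suc m) = (\<lambda>s. A s + (\<Sum>\<^sub>\<infinity>k. b k s * (cc (Suc k) s * E m (shift_first (Suc k) s))))" for m
    by (simp add: E_def)
  define V where "V = (\<lambda>m. {s \<in> Cn r. shift_first m s \<in> ?U})"
  have V_open: "openin (cspace r) (V m)" for m
    unfolding V_def by (rule openin_shift_first_vimage[OF openin_multL_domain r])
  have V_mono: "s \<in> V m \<Longrightarrow> m \<le> n \<Longrightarrow> s \<in> V n" for s m n
    using shift_first_multL_domain[OF _ r, of "shift_first m s" "n - m"]
    by (auto simp: V_def shift_first_add)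
  have V_shift: "s \<in> V (Suc m) \<Longrightarrow> shift_first (Suc k) s \<in> V m" for s m k
    using V_mono[of s "Suc m" "m + Suc k"] shift_first_Cn[OF _ r, of s "Suc k"]
    unfolding V_def by (simp add: shift_first_add)
  have V0: "V 0 = ?U" using multL_domain_subset by (auto simp: V_def)
  have Qcc: "Q s = cc k s * Q (shift_first k s)" if "s \<in> Cn r" for k s
  proof (induction k)
    case (Suc k)
    have "Q (shift_first k s) = c (shift_first k s) * Q (shift_first 1 (shift_first k s))"
      by (rule Qc[OF shift_first_Cn[OF that r]])
    also have "shift_first 1 (shift_first k s) = shift_first (Suc k) s"
      by (simp add: shift_first_add)
    finally have *: "Q (shift_first k s) = c (shift_first k s) * Q (shift_first (Suc k) s)" .
    have "cc (Suc k) s = cc k s * c (shift_first k s)" by (simp add: cc_def)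
    then show ?case using Suc.IH * by (simp only: mult.assoc)
  qed (simp add: cc_def)
  \<comment> \<open>For \<open>m = 0\<close> this is \<open>rec\<close>. Later, a point of
    \<open>V (Suc m)\<close> has all its positive translates in \<open>V m\<close>, where the
    induction hypothesis applies term by term.\<close>
  have E_Suc: "E (Suc m) s = E m s" if "s \<in> V m" for m s
    using that
  proof (induction m arbitrary: s)
    case 0
    then have s: "s \<in> ?U" "s \<in> Cn r" using V0 by (auto simp: V_def)
    have "Q s * L (shift_first (Suc k) s) = cc (Suc k) s * E 0 (shift_first (Suc k) s)" for k
      by (subst Qcc[OF s(2), of "Suc k"]) (simp only: E0 mult.assoc)
    then have "E (Suc 0) s = Q s * L s"
      using rec[OF s(1)] by (simp only: ES)
    then show ?case by (simp only: E0)
  next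
    case (Suc m)
    show ?case
      unfolding ES[of "Suc m"] using Suc.IH[OF V_shift[OF Suc.prems]]
      by (simp add: ES[of m])
  qed
  have E_eq: "E n s = E m s" if "s \<in> V m" "m \<le> n" for m n s
    using that(2)
  proof (induction n rule: dec_induct)
    case (step n)
    then show ?case using E_Suc V_mono[OF that(1)] by auto
  qed simp
  have cc_hol: "holomorphic_Cn r (Cn r) (cc k)" for k
    unfolding cc_def by (intro holomorphic_Cn_prod holomorphic_Cn_shift_first[OF c])
      (use shift_first_Cn[OF _ r] in auto)
  have E_hol: "holomorphic_Cn r (V m) (E m)" for m
  proof (induction m)
    case 0
    then show ?case
      unfolding E0 V0
      by (intro holomorphic_Cn_mult L holomorphic_Cn_subset[OF Q] openin_multL_domain multL_domain_subset)
  next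
    case (Suc m)
    show ?case
    proof (rule holomorphic_Cn_local)
      fix a assume a: "a \<in> V (Suc m)"
      then have aC: "a \<in> Cn r" by (simp add: V_def)
      obtain R where R: "R > 0" "a \<in> coord_box r R" using in_coord_box[OF aC] by blast
      define W where "W = V (Suc m) \<inter> coord_box r R"
      have W: "openin (cspace r) W" "a \<in> W" "W \<subseteq> V (Suc m)" "W \<subseteq> Cn r"
        using V_open openin_coord_box a R by (auto simp: W_def V_def)
      obtain N g where g: "g summable_on UNIV"
        and N: "\<And>s k. s \<in> coord_box r R \<Longrightarrow> k \<ge> N \<Longrightarrow> shift_first (Suc k) s \<in> ?U"
        and bound: "\<And>s k. s \<in> coord_box r R \<Longrightarrow> k \<ge> N \<Longrightarrow>
           cmod (b k s * L (shift_first (Suc k) s)) \<le> g k"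
        using decay[OF R(1)] by metis
      define t where "t = (\<lambda>k s. b k s * L (shift_first (Suc k) s))"
      have gN: "g summable_on {N..}" using g by (rule summable_on_subset_banach) auto
      have t_hol: "holomorphic_Cn r W (\<lambda>s. \<Sum>\<^sub>\<infinity>k\<in>{N..}. t k s)"
      proof (rule holomorphic_Cn_infsum[OF W(1) _ _ gN])
        show "holomorphic_Cn r W (t k)" if "k \<in> {N..}" for k
          unfolding t_def using that N W
          by (intro holomorphic_Cn_mult holomorphic_Cn_subset[OF b] holomorphic_Cn_shift_first[OF L])
             (auto simp: W_def)
        show "cmod (t k s) \<le> g k" if "k \<in> {N..}" "s \<in> W" for k s
          unfolding t_def using that bound by (auto simp: W_def)
      qed
      \<comment> \<open>Only the first \<open>N\<close> translates can lie outside the domain of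
        \<open>L\<close>; their terms use \<open>E m\<close> on \<open>V m\<close>. From
        \<open>N\<close> on the terms have the common factor \<open>Q s\<close>, and what remains is
        dominated on the box by \<open>g\<close>.\<close>
      define S where "S = (\<lambda>s. A s +
         ((\<Sum>k<N. b k s * (cc (Suc k) s * E m (shift_first (Suc k) s))) + Q s * (\<Sum>\<^sub>\<infinity>k\<in>{N..}. t k s)))"
      have "holomorphic_Cn r W S"
        unfolding S_def using W
        by (intro holomorphic_Cn_add holomorphic_Cn_sum holomorphic_Cn_mult t_hol
              holomorphic_Cn_subset[OF A] holomorphic_Cn_subset[OF b] holomorphic_Cn_subset[OF cc_hol]
              holomorphic_Cn_subset[OF Q] holomorphic_Cn_shift_first[OF Suc.IH] V_shift) auto
      moreover have "S s = E (Suc m) s" if s: "s \<in> W" for s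
      proof -
        let ?f = "\<lambda>k. b k s * (cc (Suc k) s * E m (shift_first (Suc k) s))"
        have sC: "s \<in> Cn r" using s W by auto
        have eq: "?f k = Q s * t k s" if "k \<ge> N" for k
        proof -
          have "shift_first (Suc k) s \<in> V 0" using N[of s k] s that by (auto simp: W_def V0)
          then have "E m (shift_first (Suc k) s) = Q (shift_first (Suc k) s) * L (shift_first (Suc k) s)"
            using E_eq[of _ 0 m] by (simp add: E0)
          then show ?thesis using Qcc[OF sC, of "Suc k"] by (simp add: t_def mult_ac)
        qed
        have "(\<lambda>k. t k s) summable_on {N..}"
          by (rule abs_summable_summable, rule summable_on_comparison_test[OF gN])
             (use s bound in \<open>auto simp: t_def W_def\<close>)
        then have "(\<lambda>k. Q s * t k s) summable_on {N..}" by (rule summable_on_cmult_right)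
        then have "?f summable_on {N..}" using eq by (subst summable_on_cong) auto
        then have "infsum ?f ({..<N} \<union> {N..}) = infsum ?f {..<N} + infsum ?f {N..}"
          by (intro infsum_Un_disjoint) auto
        also have "{..<N} \<union> {N..} = UNIV" by auto
        also have "infsum ?f {N..} = (\<Sum>\<^sub>\<infinity>k\<in>{N..}. Q s * t k s)"
          using eq by (intro infsum_cong) auto
        finally show ?thesis
          unfolding ES S_def by (simp add: infsum_cmult_right')
      qed
      ultimately have "holomorphic_Cn r W (E (Suc m))" by (rule holomorphic_Cn_cong)
      then show "\<exists>W. a \<in> W \<and> W \<subseteq> V (Suc m) \<and> holomorphic_Cn r W (E (Suc m))"
        using W by blast
    qed
  qed
  have ex: "\<exists>m. s \<in> V m" if "s \<in> Cn r" for s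
    using shift_first_in_multL_domain_ex[OF that r] that by (auto simp: V_def)
  define H where "H = (\<lambda>s. E (LEAST m. s \<in> V m) s)"
  have H: "H s = E m s" if "s \<in> V m" for s m
  proof -
    have "(LEAST m. s \<in> V m) \<le> m" "s \<in> V (LEAST m. s \<in> V m)"
      using that by (auto intro: Least_le LeastI)
    then show ?thesis unfolding H_def by (intro E_eq[symmetric])
  qed
  have "holomorphic_Cn r (Cn r) H"
  proof (rule holomorphic_Cn_local)
    fix a assume "a \<in> Cn r"
    then obtain m where "a \<in> V m" using ex by blast
    moreover have "holomorphic_Cn r (V m) H"
      by (rule holomorphic_Cn_cong[OF E_hol]) (simp add: H)
    ultimately show "\<exists>W. a \<in> W \<and> W \<subseteq> Cn r \<and> holomorphic_Cn r W H"
      by (intro exI[of _ "V m"]) (auto simp: V_def)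
  qed
  moreover have "H s = Q s * L s" if "s \<in> ?U" for s
    using H[of s 0] that by (simp add: V0 E0)
  moreover have "H s / Q s = A s / Q s +
      (\<Sum>\<^sub>\<infinity>k. b k s * (H (shift_first (Suc k) s) / Q (shift_first (Suc k) s)))"
    if s: "s \<in> Cn r" "Q s \<noteq> 0" for s
  proof -
    obtain m where m: "s \<in> V m" using ex s by blast
    then have m': "s \<in> V (Suc m)" using V_mono by simp
    have "b k s * (cc (Suc k) s * E m (shift_first (Suc k) s)) =
        Q s * (b k s * (H (shift_first (Suc k) s) / Q (shift_first (Suc k) s)))" for k
    proof -
      \<comment> \<open>By \<open>Qcc\<close> the value of \<open>Q\<close> at the translate is a
        factor of \<open>Q s\<close>, hence nonzero, and the division is legitimate.\<close>
      have "cc (Suc k) s = Q s / Q (shift_first (Suc k) s)"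
        using Qcc[OF s(1), of "Suc k"] s(2) by (metis mult_eq_0_iff nonzero_mult_div_cancel_right)
      then show ?thesis
        unfolding H[OF V_shift[OF m', of k]]
        by (simp only: ac_simps times_divide_eq_left times_divide_eq_right)
    qed
    then have "H s = A s +
        Q s * (\<Sum>\<^sub>\<infinity>k. b k s * (H (shift_first (Suc k) s) / Q (shift_first (Suc k) s)))"
      using H[OF m'] by (simp only: ES infsum_cmult_right')
    then show ?thesis using s(2) by (simp add: add_divide_distrib)
  qed
  ultimately show ?thesis by blast
qed

section \<open>Multiple series in the domain of convergence\<close>

text \<open>This is the binomial series of \<open>(n - 1) powr (- s)\<close>, convergent because
  \<open>1 < n\<close>. Its term of index \<open>0\<close> is \<open>n powr (- s)\<close>; moving it
  to the other side leaves the coefficients with \<open>k + 1\<close> factors.\<close>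

lemma rising_translation:
  assumes "2 \<le> n"
  shows "(\<lambda>k. rising s k * of_nat n powr (- s - of_nat (Suc k))) sums
    (of_nat (n - 1) powr (- s) - of_nat n powr (- s))"
proof -
  have "(\<lambda>m. (- s gchoose m) * of_real (real n) powr (- s - of_nat m) * of_real (- 1) ^ m) sums
     of_real (real n + - 1) powr (- s)"
    by (rule gen_binomial_complex'') (use assms in auto)
  also have "complex_of_real (real n + - 1) = of_nat (n - 1)"
    using assms by (simp add: of_nat_diff)
  also have "(\<lambda>m. (- s gchoose m) * of_real (real n) powr (- s - of_nat m) * of_real (- 1) ^ m) =
      (\<lambda>m. pochhammer s m / fact m * of_nat n powr (- s - of_nat m))"
  proof
    fix m
    have "(- s gchoose m) * (- 1) ^ m = pochhammer s m / fact m * ((- 1) ^ m * (- 1) ^ m)"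
      by (simp add: gbinomial_pochhammer)
    also have "(- 1) ^ m * (- 1) ^ m = (1 :: complex)"
      by (simp flip: power_mult_distrib)
    finally have *: "(- s gchoose m) * (- 1) ^ m = pochhammer s m / fact m" by simp
    have "(- s gchoose m) * of_real (real n) powr (- s - of_nat m) * of_real (- 1) ^ m =
        (- s gchoose m) * (- 1) ^ m * of_nat n powr (- s - of_nat m)"
      by (simp only: of_real_of_nat_eq of_real_minus of_real_1 mult_ac)
    then show "(- s gchoose m) * of_real (real n) powr (- s - of_nat m) * of_real (- 1) ^ m =
        pochhammer s m / fact m * of_nat n powr (- s - of_nat m)"
      by (simp only: *)
  qed
  finally have "(\<lambda>m. pochhammer s m / fact m * of_nat n powr (- s - of_nat m)) sums
      of_nat (n - 1) powr (- s)" .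
  then show ?thesis
    unfolding rising_def
    by (intro iffD2[OF sums_Suc_iff[of "\<lambda>m. pochhammer s m / fact m * of_nat n powr (- s - of_nat m)"]])
       simp
qed

definition rising_bound :: "real \<Rightarrow> nat \<Rightarrow> real" where
  "rising_bound R k = pochhammer R (Suc k) / fact (Suc k)"

lemma norm_rising_le: 
  assumes "cmod s \<le> R"
  shows "cmod (rising s k) \<le> rising_bound R k"
proof -
  have "cmod (pochhammer s (Suc k)) = (\<Prod>i=0..<Suc k. cmod (s + of_nat i))"
    by (simp only: pochhammer_prod prod_norm)
  also have "\<dots> \<le> (\<Prod>i=0..<Suc k. R + real i)"
  proof (rule prod_mono, intro conjI)
    fix i
    have "cmod (s + of_nat i) \<le> cmod s + cmod (of_nat i)" by (rule norm_triangle_ineq)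
    then show "cmod (s + of_nat i) \<le> R + real i" using assms by simp
  qed simp
  also have "\<dots> = pochhammer R (Suc k)" by (simp only: pochhammer_prod)
  finally show ?thesis
    unfolding rising_def rising_bound_def norm_divide norm_fact by (intro divide_right_mono) auto
qed

lemma rising_bound_nonneg: "0 \<le> R \<Longrightarrow> 0 \<le> rising_bound R k"
  unfolding rising_bound_def pochhammer_prod by (intro divide_nonneg_nonneg prod_nonneg) auto

text \<open>Up to an index shift, which costs a factor \<open>2\<close>, these are the terms of the
  binomial series for \<open>(1 - x) powr (- R)\<close> at \<open>x = 1 / 2\<close>. The weight
  \<open>2 ^ k\<close> is what \<open>n 1 \<ge> 2\<close> provides in every term of the multiple
  series.\<close>

lemma rising_bound_summable:
  assumes "0 \<le> R"
  shows "(\<lambda>k. rising_bound R k / 2 ^ k) summable_on UNIV"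
proof -
  have "(\<lambda>k. (- R gchoose k) * (- 1 / 2) ^ k) sums (1 + - 1 / 2) powr (- R)"
    by (rule gen_binomial_real) simp
  moreover have "(- R gchoose k) * (- 1 / 2) ^ k = pochhammer R k / fact k / 2 ^ k" for k
  proof -
    have "(- R gchoose k) * (- 1 / 2) ^ k = pochhammer R k / fact k * ((- 1) ^ k * (- 1 / 2) ^ k)"
      by (simp add: gbinomial_pochhammer)
    also have "(- 1) ^ k * (- 1 / 2) ^ k = (1 / 2 :: real) ^ k"
      by (simp flip: power_mult_distrib)
    finally show ?thesis by (simp add: power_divide)
  qed
  ultimately have "summable (\<lambda>k. pochhammer R k / fact k / 2 ^ k)" by (simp add: sums_iff)
  then have "summable (\<lambda>k. 2 * (pochhammer R (Suc k) / fact (Suc k) / 2 ^ Suc k))"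
    by (subst (asm) summable_Suc_iff[symmetric]) (rule summable_mult)
  then have "summable (\<lambda>k. rising_bound R k / 2 ^ k)"
    by (rule summable_cong[THEN iffD1, rotated]) (auto simp: rising_bound_def)
  then show ?thesis
    by (subst summable_on_UNIV_nonneg_real_iff) (auto simp: rising_bound_nonneg assms)
qed

section \<open>Terms of the multiple series and their absolute convergence\<close>

definition Lterm :: "nat \<Rightarrow> (nat \<Rightarrow> complex) \<Rightarrow> (nat \<Rightarrow> complex) \<Rightarrow> (nat \<Rightarrow> nat) \<Rightarrow> complex" where
  "Lterm d z s n = (\<Prod>i\<in>{1..d}. z i ^ n i / of_nat (n i) powr s i)"

text \<open>
  The translation identity for a single term needs \<open>n\<^sub>1 \<ge> 2\<close>, which is automatic only for \<open>d \<ge> 2\<close>.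
\<close>

definition big_tuples :: "nat \<Rightarrow> (nat \<Rightarrow> nat) set" where
  "big_tuples d = {n \<in> decreasing_tuples d. 2 \<le> n 1}"

definition Ltail :: "nat \<Rightarrow> (nat \<Rightarrow> complex) \<Rightarrow> (nat \<Rightarrow> complex) \<Rightarrow> complex" where
  "Ltail d z s = (\<Sum>\<^sub>\<infinity>n\<in>big_tuples d. Lterm d z s n)"

definition bounded_partial_prods :: "nat \<Rightarrow> (nat \<Rightarrow> complex) \<Rightarrow> bool" where
  "bounded_partial_prods d z \<longleftrightarrow> (\<forall>i\<in>{1..d}. cmod (\<Prod>j\<in>{1..i}. z j) \<le> 1)"

text \<open>A homomorphism on the integers is determined by its value at \<open>1\<close>, which is
  why the terms of the series carry numbers \<open>z i\<close> instead of characters.\<close>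

lemma additive_character_nat:
  assumes "additive_character h"
  shows "h (int n) = h 1 ^ n"
proof (induction n)
  case 0
  have "h (0 + 0) = h 0 * h 0" "h 0 \<noteq> 0"
    using assms unfolding additive_character_def by blast+
  then show ?case by simp
next
  case (Suc n)
  have "h (int n + 1) = h (int n) * h 1" using assms unfolding additive_character_def by blast
  then show ?case using Suc by (simp add: add.commute mult.commute)
qed

lemma multL_eq_Lterm:
  assumes "\<And>i. i \<in> {1..d} \<Longrightarrow> additive_character (h i)"
  shows "multL d h s = (\<Sum>\<^sub>\<infinity>n\<in>decreasing_tuples d. Lterm d (\<lambda>i. h i 1) s n)"
  unfolding multL_def Lterm_def
  by (intro infsum_cong) (simp add: prod_dividef additive_character_nat[OF assms])

lemma decreasing_tuples_pos: "n \<in> decreasing_tuples d \<Longrightarrow> i \<in> {1..d} \<Longrightarrow> 0 < n i"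
  by (auto simp: decreasing_tuples_def PiE_iff)

lemma decreasing_tuples_Suc: "n \<in> decreasing_tuples d \<Longrightarrow> 1 \<le> i \<Longrightarrow> Suc i \<le> d \<Longrightarrow> n (Suc i) < n i"
  by (auto simp: decreasing_tuples_def)

text \<open>
  Summation by parts for products: replacing each \<open>n i\<close> by the smaller \<open>n (i + 1)\<close> in the power of
  the partial product increases it.
\<close>

lemma abel_product_le_1:
  fixes a \<tau> :: "nat \<Rightarrow> real" and n :: "nat \<Rightarrow> nat"
  assumes a: "\<And>i. i \<in> {1..d} \<Longrightarrow> 0 \<le> a i"
    and P: "\<And>i. i \<in> {1..d} \<Longrightarrow> (\<Prod>j\<in>{1..i}. a j) \<le> 1"
    and T: "\<And>i. i \<in> {1..d} \<Longrightarrow> 0 \<le> (\<Sum>j\<in>{1..i}. \<tau> j)"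
    and n: "n \<in> decreasing_tuples d"
  shows "(\<Prod>i\<in>{1..d}. a i ^ n i * real (n i) powr (- \<tau> i)) \<le> 1"
proof (cases "d = 0")
  case False
  have P0: "0 \<le> (\<Prod>j\<in>{1..i}. a j)" if "i \<le> d" for i
    using a that by (intro prod_nonneg) auto
  have le: "(\<Prod>i\<in>{1..Suc j}. a i ^ n i * real (n i) powr (- \<tau> i)) \<le>
     (\<Prod>i\<in>{1..Suc j}. a i) ^ n (Suc j) * real (n (Suc j)) powr (- (\<Sum>i\<in>{1..Suc j}. \<tau> i))"
    if "Suc j \<le> d" for j
    using that
  proof (induction j)
    case (Suc j)
    let ?p = "\<Prod>i\<in>{1..Suc j}. a i" and ?t = "\<Sum>i\<in>{1..Suc j}. \<tau> i"
    let ?n = "n (Suc j)" and ?m = "n (Suc (Suc j))"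
    have mn: "0 < ?m" "?m < ?n"
      using decreasing_tuples_pos[OF n, of "Suc (Suc j)"] decreasing_tuples_Suc[OF n, of "Suc j"] Suc.prems
      by auto
    have "(\<Prod>i\<in>{1..Suc j}. a i ^ n i * real (n i) powr (- \<tau> i)) \<le> ?p ^ ?n * real ?n powr (- ?t)"
      using Suc by simp
    also have "\<dots> \<le> ?p ^ ?m * real ?m powr (- ?t)"
    proof (rule mult_mono)
      show "?p ^ ?n \<le> ?p ^ ?m"
        using P0[of "Suc j"] P[of "Suc j"] mn Suc.prems by (intro power_decreasing) auto
      show "real ?n powr (- ?t) \<le> real ?m powr (- ?t)"
        using T[of "Suc j"] mn Suc.prems by (intro powr_mono2') auto
    qed (use P0[of "Suc j"] Suc.prems in auto)
    finally have "(\<Prod>i\<in>{1..Suc j}. a i ^ n i * real (n i) powr (- \<tau> i)) \<le>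
        ?p ^ ?m * real ?m powr (- ?t)" .
    then have "(\<Prod>i\<in>{1..Suc j}. a i ^ n i * real (n i) powr (- \<tau> i)) *
          (a (Suc (Suc j)) ^ ?m * real ?m powr (- \<tau> (Suc (Suc j)))) \<le>
        ?p ^ ?m * real ?m powr (- ?t) * (a (Suc (Suc j)) ^ ?m * real ?m powr (- \<tau> (Suc (Suc j))))"
      using a[of "Suc (Suc j)"] Suc.prems by (intro mult_right_mono) auto
    also have "\<dots> = (?p * a (Suc (Suc j))) ^ ?m * real ?m powr (- (?t + \<tau> (Suc (Suc j))))"
      by (simp add: power_mult_distrib powr_add[symmetric] mult_ac)
    finally show ?case by simp
  qed simp
  from False obtain j where j: "d = Suc j" by (cases d) auto
  have "(\<Prod>i\<in>{1..d}. a i) ^ n d * real (n d) powr (- (\<Sum>i\<in>{1..d}. \<tau> i)) \<le> 1 * 1"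
  proof (rule mult_mono)
    show "(\<Prod>i\<in>{1..d}. a i) ^ n d \<le> 1"
      using P[of d] P0[of d] False by (intro power_le_one) auto
    have "1 \<le> real (n d)" using decreasing_tuples_pos[OF n, of d] False by auto
    then have "real (n d) powr (- (\<Sum>i\<in>{1..d}. \<tau> i)) \<le> 1 powr (- (\<Sum>i\<in>{1..d}. \<tau> i))"
      using T[of d] False by (intro powr_mono2') auto
    then show "real (n d) powr (- (\<Sum>i\<in>{1..d}. \<tau> i)) \<le> 1" by simp
  qed auto
  then show ?thesis using le[of j] j by simp
qed simp

definition weight_bound :: "nat \<Rightarrow> real \<Rightarrow> (nat \<Rightarrow> nat) \<Rightarrow> real" where
  "weight_bound d \<delta> n = (\<Prod>i\<in>{1..d}. real (n i) powr (- (1 + \<delta>)))"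

text \<open>The exponent is split as \<open>Re (s i) = \<tau> i + (1 + \<delta>)\<close>. The
  hypothesis says exactly that the partial sums of \<open>\<tau>\<close> are nonnegative, so the
  part with \<open>z\<close> and \<open>\<tau>\<close> has product at most \<open>1\<close>,
  although single factors may be large; the rest is \<open>weight_bound\<close>.\<close>

lemma Lterm_bound:
  assumes z: "bounded_partial_prods d z" and n: "n \<in> decreasing_tuples d"
    and s: "\<And>i. i \<in> {1..d} \<Longrightarrow> real i * (1 + \<delta>) \<le> Re (\<Sum>j\<in>{1..i}. s j)"
  shows "cmod (Lterm d z s n) \<le> weight_bound d \<delta> n"
proof -
  define \<tau> where "\<tau> = (\<lambda>i. Re (s i) - (1 + \<delta>))"
  have "cmod (Lterm d z s n) =
      (\<Prod>i\<in>{1..d}. (cmod (z i) ^ n i * real (n i) powr (- \<tau> i)) * real (n i) powr (- (1 + \<delta>)))"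
    unfolding Lterm_def prod_norm[symmetric]
  proof (rule prod.cong[OF refl])
    fix i assume "i \<in> {1..d}"
    then have "0 < n i" using decreasing_tuples_pos[OF n] by auto
    then show "cmod (z i ^ n i / of_nat (n i) powr s i) =
        (cmod (z i) ^ n i * real (n i) powr (- \<tau> i)) * real (n i) powr (- (1 + \<delta>))"
      using norm_powr_real_powr[of "of_nat (n i)" "s i"]
      by (simp add: norm_divide norm_power \<tau>_def mult.assoc powr_add[symmetric]
            powr_minus divide_inverse norm_mult norm_inverse)
  qed
  also have "\<dots> = (\<Prod>i\<in>{1..d}. cmod (z i) ^ n i * real (n i) powr (- \<tau> i)) * weight_bound d \<delta> n"
    by (simp only: prod.distrib weight_bound_def)
  also have "\<dots> \<le> 1 * weight_bound d \<delta> n"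
  proof (intro mult_right_mono abel_product_le_1[OF _ _ _ n])
    fix i assume i: "i \<in> {1..d}"
    show "(\<Prod>j\<in>{1..i}. cmod (z j)) \<le> 1"
      using z i by (auto simp: bounded_partial_prods_def prod_norm)
    have "(\<Sum>j\<in>{1..i}. \<tau> j) = Re (\<Sum>j\<in>{1..i}. s j) - real i * (1 + \<delta>)"
      by (simp add: \<tau>_def sum_subtractf)
    then show "0 \<le> (\<Sum>j\<in>{1..i}. \<tau> j)" using s[OF i] by linarith
  qed (auto simp: weight_bound_def intro!: prod_nonneg)
  finally show ?thesis by simp
qed

lemma summable_on_powr: "\<delta> > 0 \<Longrightarrow> (\<lambda>n. real n powr (- (1 + \<delta>))) summable_on A"
proof -
  assume "\<delta> > 0"
  then have "summable (\<lambda>n. real n powr (- (1 + \<delta>)))" by (subst summable_real_powr_iff) auto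
  then have "(\<lambda>n. real n powr (- (1 + \<delta>))) summable_on UNIV"
    by (subst summable_on_UNIV_nonneg_real_iff) auto
  then show ?thesis by (rule summable_on_subset_banach) auto
qed

text \<open>Once the order of the entries is dropped, the sum over the full product set factorizes
  into \<open>d\<close> convergent series in one variable.\<close>

lemma weight_bound_summable:
  assumes "\<delta> > 0" "J \<subseteq> decreasing_tuples d"
  shows "weight_bound d \<delta> summable_on J"
proof -
  have "Infinite_Set_Sum.abs_summable_on (\<lambda>n. real n powr (- (1 + \<delta>))) {0<..}"
    using summable_on_powr[OF assms(1), of "{0<..}"]
    by (intro iffD1[OF abs_summable_equivalent]) simp
  then have "Infinite_Set_Sum.abs_summable_on (\<lambda>g. \<Prod>x\<in>{1..d}. real (g x) powr (- (1 + \<delta>))) (PiE {1..d} (\<lambda>_. {0<..}))"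
    by (rule abs_summable_on_prod_PiE[of "{1..d}" "\<lambda>_. {0<..}" "\<lambda>_ n. real n powr (- (1 + \<delta>))",
          OF finite_atLeastAtMost countableI_type])
  then have "(\<lambda>g. \<Prod>x\<in>{1..d}. real (g x) powr (- (1 + \<delta>))) summable_on (PiE {1..d} (\<lambda>_. {0<..}))"
    by (rule abs_summable_summable[OF iffD2[OF abs_summable_equivalent]])
  moreover have "J \<subseteq> PiE {1..d} (\<lambda>_. {0<..})"
    using assms by (auto simp: decreasing_tuples_def)
  ultimately show ?thesis
    unfolding weight_bound_def[abs_def] by (rule summable_on_subset_banach)
qed

lemma multL_domain_margin:
  assumes "s \<in> multL_domain d"
  shows "\<exists>\<delta>>0. \<forall>i\<in>{1..d}. real i * (1 + \<delta>) < Re (\<Sum>j\<in>{1..i}. s j)"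
proof -
  have "\<forall>\<^sub>F \<delta> in at_right 0. \<forall>i\<in>{1..d}. real i * (1 + \<delta>) < Re (\<Sum>j\<in>{1..i}. s j)"
  proof (rule eventually_ball_finite, simp, intro ballI)
    fix i assume "i \<in> {1..d}"
    then have "real i < Re (\<Sum>j\<in>{1..i}. s j)" using assms unfolding multL_domain_def by blast
    moreover have "((\<lambda>\<delta>. real i * (1 + \<delta>)) \<longlongrightarrow> real i * (1 + 0)) (at_right 0)"
      by (intro tendsto_intros)
    ultimately show "\<forall>\<^sub>F \<delta> in at_right 0. real i * (1 + \<delta>) < Re (\<Sum>j\<in>{1..i}. s j)"
      using order_tendstoD(2)[of _ "real i * (1 + 0)" "at_right 0"] by force
  qed
  then have "\<forall>\<^sub>F \<delta> in at_right 0. \<delta> > 0 \<and> (\<forall>i\<in>{1..d}. real i * (1 + \<delta>) < Re (\<Sum>j\<in>{1..i}. s j))"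
    by (intro eventually_conj eventually_at_right_less)
  then show ?thesis
    using eventually_happens'[of "at_right (0::real)"] by force
qed

lemma Lterm_summable:
  assumes "bounded_partial_prods d z" "s \<in> multL_domain d" "J \<subseteq> decreasing_tuples d"
  shows "Lterm d z s summable_on J"
proof -
  obtain \<delta> where "\<delta> > 0" "\<forall>i\<in>{1..d}. real i * (1 + \<delta>) < Re (\<Sum>j\<in>{1..i}. s j)"
    using multL_domain_margin[OF assms(2)] by blast
  then have "cmod (Lterm d z s n) \<le> weight_bound d \<delta> n" if "n \<in> J" for n
    using assms(3) that by (intro Lterm_bound[OF assms(1)]) (auto intro: less_imp_le simp del: Re_sum)
  then show ?thesis
    by (intro abs_summable_summable[OF summable_on_comparison_test[OF weight_bound_summable[OF \<open>\<delta> > 0\<close> assms(3)]]]) auto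
qed

lemma holomorphic_Cn_Lterm:
  assumes "openin (cspace d) V" "n \<in> decreasing_tuples d"
  shows "holomorphic_Cn d V (\<lambda>s. Lterm d z s n)"
  unfolding Lterm_def
proof (intro holomorphic_Cn_prod assms(1))
  fix i assume "i \<in> {1..d}"
  then have "n i > 0" using assms decreasing_tuples_pos by blast
  then have "(\<lambda>w. z i ^ n i / of_nat (n i) powr w) holomorphic_on UNIV"
    by (intro holomorphic_intros) auto
  from holomorphic_Cn_compose1[OF holomorphic_Cn_coord[OF assms(1), of i] this]
  show "holomorphic_Cn d V (\<lambda>s. z i ^ n i / of_nat (n i) powr s i)" .
qed

text \<open>A margin at \<open>a\<close> persists on a neighbourhood \<open>W\<close>, where
  \<open>weight_bound d \<delta>\<close> dominates all terms uniformly. The index set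
  \<open>J\<close> is left free so that depth one can omit the tuple with entry
  \<open>1\<close>.\<close>

lemma holomorphic_Cn_Lterm_sum:
  assumes z: "bounded_partial_prods d z" and J: "J \<subseteq> decreasing_tuples d"
  shows "holomorphic_Cn d (multL_domain d) (\<lambda>s. \<Sum>\<^sub>\<infinity>n\<in>J. Lterm d z s n)"
proof (rule holomorphic_Cn_local)
  fix a assume a: "a \<in> multL_domain d"
  obtain \<delta> where \<delta>: "\<delta> > 0" "\<forall>i\<in>{1..d}. real i * (1 + \<delta>) < Re (\<Sum>j\<in>{1..i}. a j)"
    using multL_domain_margin[OF a] by blast
  define W where "W = {s \<in> Cn d. \<forall>i\<in>{1..d}. real i * (1 + \<delta>) < Re (\<Sum>j\<in>{1..i}. s j)}"
  have W: "openin (cspace d) W" unfolding W_def by (rule openin_partial_sums_gt)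
  have "W \<subseteq> multL_domain d"
  proof
    fix s assume s: "s \<in> W"
    have "real i < Re (\<Sum>j\<in>{1..i}. s j)" if "i \<in> {1..d}" for i
    proof -
      have "real i * 1 \<le> real i * (1 + \<delta>)" using \<delta> by (intro mult_left_mono) auto
      also have "\<dots> < Re (\<Sum>j\<in>{1..i}. s j)" using s that unfolding W_def by blast
      finally show ?thesis by simp
    qed
    then show "s \<in> multL_domain d" using s unfolding W_def multL_domain_def by blast
  qed
  moreover have "a \<in> W" using a \<delta> unfolding W_def multL_domain_def by blast
  moreover have "holomorphic_Cn d W (\<lambda>s. \<Sum>\<^sub>\<infinity>n\<in>J. Lterm d z s n)"
  proof (rule holomorphic_Cn_infsum[OF W _ _ weight_bound_summable[OF \<delta>(1) J]])
    show "holomorphic_Cn d W (\<lambda>s. Lterm d z s n)" if "n \<in> J" for n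
      using that J W holomorphic_Cn_Lterm by blast
    show "cmod (Lterm d z s n) \<le> weight_bound d \<delta> n" if "n \<in> J" "s \<in> W" for n s
      using that J by (intro Lterm_bound[OF z]) (auto simp: W_def intro: less_imp_le simp del: Re_sum)
  qed
  ultimately show "\<exists>W. a \<in> W \<and> W \<subseteq> multL_domain d \<and>
      holomorphic_Cn d W (\<lambda>s. \<Sum>\<^sub>\<infinity>n\<in>J. Lterm d z s n)"
    by blast
qed

lemma big_tuples_subset: "big_tuples d \<subseteq> decreasing_tuples d"
  by (auto simp: big_tuples_def)

lemma big_tuples_eq: "2 \<le> d \<Longrightarrow> big_tuples d = decreasing_tuples d"
proof -
  assume "2 \<le> d"
  then have "2 \<le> n 1" if "n \<in> decreasing_tuples d" for n
    using decreasing_tuples_pos[OF that, of 2] decreasing_tuples_Suc[OF that, of 1]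
    by (simp add: numeral_2_eq_2)
  then show ?thesis by (auto simp: big_tuples_def)
qed

text \<open>Source of the decay: each unit of translation gains a factor \<open>1 / n 1\<close>, at
  most \<open>1 / 2\<close> on \<open>big_tuples\<close>.\<close>

lemma Lterm_shift_first:
  assumes "1 \<le> d" "n 1 > 0"
  shows "Lterm d z (shift_first k s) n = Lterm d z s n / of_nat (n 1) ^ k"
proof -
  have *: "{1..d} = insert 1 {2..d}" using assms by auto
  have "(\<Prod>i\<in>{2..d}. z i ^ n i / of_nat (n i) powr shift_first k s i) =
      (\<Prod>i\<in>{2..d}. z i ^ n i / of_nat (n i) powr s i)"
    by (rule prod.cong) (auto simp: shift_first_def)
  then show ?thesis
    unfolding Lterm_def * using assms
    by (simp add: shift_first_def powr_add powr_nat' field_simps)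
qed

text \<open>After \<open>N\<close> steps the whole box lies in the domain with margin
  \<open>1\<close>, so \<open>weight_bound d 1\<close> dominates there; every further step halves
  the bound.\<close>

lemma Ltail_decay:
  assumes z: "bounded_partial_prods d z" and d: "1 \<le> d" and R: "R > 0"
  shows "\<exists>N C. C \<ge> 0 \<and> (\<forall>s\<in>coord_box d R. \<forall>k\<ge>N.
     shift_first k s \<in> multL_domain d \<and> cmod (Ltail d z (shift_first k s)) \<le> C / 2 ^ k)"
proof -
  obtain N :: nat where N: "real N \<ge> real d * (R + 1 + 1)" using real_arch_simple by blast
  \<comment> \<open>The factor \<open>2 ^ N\<close> turns the denominator \<open>2 ^ (k - N)\<close>
    into \<open>2 ^ k\<close>.\<close>
  define C where "C = 2 ^ N * (\<Sum>\<^sub>\<infinity>n\<in>big_tuples d. weight_bound d 1 n)"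
  have sm: "weight_bound d 1 summable_on big_tuples d"
    by (rule weight_bound_summable[OF _ big_tuples_subset]) simp
  have "C \<ge> 0"
    unfolding C_def by (auto intro!: mult_nonneg_nonneg infsum_nonneg prod_nonneg simp: weight_bound_def)
  moreover have "shift_first k s \<in> multL_domain d \<and> cmod (Ltail d z (shift_first k s)) \<le> C / 2 ^ k"
    if s: "s \<in> coord_box d R" and k: "N \<le> k" for s k
  proof
    have sC: "s \<in> Cn d" using s by (simp add: coord_box_def)
    have ge: "real i * (1 + 1) \<le> Re (\<Sum>j\<in>{1..i}. shift_first N s j)" if "i \<in> {1..d}" for i
      using coord_box_shift_multL_domain[OF s d N] R that by auto
    have "real i < Re (\<Sum>j\<in>{1..i}. shift_first N s j)" if "i \<in> {1..d}" for i
      using ge[OF that] that by (auto simp del: Re_sum)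
    then have "shift_first N s \<in> multL_domain d"
      using shift_first_Cn[OF sC d] unfolding multL_domain_def by blast
    from shift_first_multL_domain[OF this d, of "k - N"]
    show "shift_first k s \<in> multL_domain d" using k by (simp add: shift_first_add)
    have le: "cmod (Lterm d z (shift_first k s) n) \<le> weight_bound d 1 n * (2 ^ N / 2 ^ k)"
      if n: "n \<in> big_tuples d" for n
    proof -
      have nd: "n \<in> decreasing_tuples d" "2 \<le> n 1" using n by (auto simp: big_tuples_def)
      have "shift_first k s = shift_first (k - N) (shift_first N s)"
        using k by (simp add: shift_first_add)
      then have "cmod (Lterm d z (shift_first k s) n) =
          cmod (Lterm d z (shift_first N s) n) / real (n 1) ^ (k - N)"
        using Lterm_shift_first[OF d, of n z "k - N" "shift_first N s"] nd
        by (simp add: norm_divide norm_power)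
      also have "\<dots> \<le> weight_bound d 1 n / 2 ^ (k - N)"
      proof (rule frac_le)
        show "cmod (Lterm d z (shift_first N s) n) \<le> weight_bound d 1 n"
          by (rule Lterm_bound[OF z nd(1) ge])
        then show "0 \<le> weight_bound d 1 n" using norm_ge_zero order_trans by blast
        show "2 ^ (k - N) \<le> real (n 1) ^ (k - N)" using nd by (intro power_mono) auto
      qed simp
      also have "\<dots> = weight_bound d 1 n * (2 ^ N / 2 ^ k)"
        using k by (simp add: power_diff)
      finally show ?thesis .
    qed
    have "(\<lambda>n. weight_bound d 1 n * (2 ^ N / 2 ^ k)) summable_on big_tuples d"
      by (rule summable_on_cmult_left[OF sm])
    moreover have "Lterm d z (shift_first k s) summable_on big_tuples d"
      by (rule Lterm_summable[OF z _ big_tuples_subset]) fact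
    ultimately have "cmod (Ltail d z (shift_first k s)) \<le> (\<Sum>\<^sub>\<infinity>n\<in>big_tuples d. weight_bound d 1 n * (2 ^ N / 2 ^ k))"
      unfolding Ltail_def
      by (intro norm_infsum_le[OF has_sum_infsum has_sum_infsum le])
    also have "\<dots> = C / 2 ^ k" by (simp only: infsum_cmult_left' C_def) simp
    finally show "cmod (Ltail d z (shift_first k s)) \<le> C / 2 ^ k" .
  qed
  ultimately show ?thesis by blast
qed

section \<open>The translation identities\<close>

lemma has_sum_diff:
  fixes f g :: "'a \<Rightarrow> complex"
  assumes "(f has_sum a) A" "(g has_sum b) A"
  shows "((\<lambda>x. f x - g x) has_sum (a - b)) A"
  using has_sum_add[OF assms(1) has_sum_cmult_right[OF assms(2), of "- 1"]] by simp

text \<open>Exchanging sums later needs unordered summation, hence absolute convergence: each step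
  in \<open>k\<close> gains \<open>1 / n \<le> 1 / 2\<close> against the growth of
  \<open>rising_bound\<close>.\<close>

lemma rising_translation_has_sum:
  assumes n: "2 \<le> n"
  shows "((\<lambda>k. rising s k * of_nat n powr (- s - of_nat (Suc k))) has_sum
    (of_nat (n - 1) powr (- s) - of_nat n powr (- s))) UNIV"
proof (rule norm_summable_imp_has_sum[OF _ rising_translation[OF n]])
  have "(\<lambda>k. rising_bound (cmod s) k / 2 ^ k * cmod (of_nat n powr (- s - 1))) summable_on UNIV"
    by (intro summable_on_cmult_left rising_bound_summable) auto
  then have sm: "summable (\<lambda>k. rising_bound (cmod s) k / 2 ^ k * cmod (of_nat n powr (- s - 1)))"
    by (rule summable_on_imp_summable)
  have "cmod (rising s k * of_nat n powr (- s - of_nat (Suc k))) \<le>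
      rising_bound (cmod s) k / 2 ^ k * cmod (of_nat n powr (- s - 1))" for k
  proof -
    have "- s - of_nat (Suc k) = (- s - 1) - of_nat k" by simp
    then have "(of_nat n :: complex) powr (- s - of_nat (Suc k)) = of_nat n powr (- s - 1) / of_nat n ^ k"
      using n by (simp only: powr_diff powr_nat') auto
    then have "cmod (rising s k * of_nat n powr (- s - of_nat (Suc k))) =
        cmod (rising s k) * (cmod (of_nat n powr (- s - 1)) / real n ^ k)"
      by (simp add: norm_mult norm_divide norm_power)
    also have "\<dots> \<le> rising_bound (cmod s) k * (cmod (of_nat n powr (- s - 1)) / 2 ^ k)"
      using n by (intro mult_mono norm_rising_le divide_left_mono power_mono)
        (auto simp: rising_bound_nonneg)
    finally show ?thesis by simp
  qed
  then show "summable (\<lambda>k. cmod (rising s k * of_nat n powr (- s - of_nat (Suc k))))"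
    by (intro summable_comparison_test'[OF sm]) simp
qed

definition Lrest :: "nat \<Rightarrow> (nat \<Rightarrow> complex) \<Rightarrow> (nat \<Rightarrow> complex) \<Rightarrow> (nat \<Rightarrow> nat) \<Rightarrow> complex" where
  "Lrest d z s n = z 1 ^ n 1 * (\<Prod>i\<in>{2..d}. z i ^ n i / of_nat (n i) powr s i)"

lemma Lterm_Lrest:
  assumes "1 \<le> d"
  shows "Lterm d z s n = Lrest d z s n * of_nat (n 1) powr (- s 1)"
proof -
  have *: "{1..d} = insert 1 {2..d}" using assms by auto
  then show ?thesis
    unfolding Lterm_def Lrest_def * by (simp add: powr_minus divide_inverse)
qed

lemma Lrest_shift_first: "Lrest d z (shift_first k s) n = Lrest d z s n"
  unfolding Lrest_def by (intro arg_cong2[where f = "(*)"] refl prod.cong) (auto simp: shift_first_def)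

text \<open>The sums over \<open>k\<close> and over tuples are exchanged, with a product majorant: a
  weight in \<open>n\<close> times a binomial term in \<open>k\<close>. The smallest translate that
  occurs is the one by \<open>1\<close>, so only this one has to lie in the domain; the case
  \<open>z 1 = 1\<close> exploits it by evaluating at a point of the domain moved back by one.
  Summability is recorded as well because \<open>infsum\<close> is \<open>0\<close> on families that
  are not summable.\<close>

lemma
  assumes z: "bounded_partial_prods d z" and d: "1 \<le> d" and s: "shift_first 1 s \<in> multL_domain d"
  shows summable_translation_difference: "(\<lambda>n. Lrest d z s n * (of_nat (n 1 - 1) powr (- s 1) - of_nat (n 1) powr (- s 1)))
      summable_on big_tuples d"
    and infsum_rising_Ltail:
      "(\<Sum>\<^sub>\<infinity>k. rising (s 1) k * Ltail d z (shift_first (Suc k) s)) =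
       (\<Sum>\<^sub>\<infinity>n\<in>big_tuples d. Lrest d z s n * (of_nat (n 1 - 1) powr (- s 1) - of_nat (n 1) powr (- s 1)))"
proof -
  obtain \<delta> where \<delta>: "\<delta> > 0"
    "\<forall>i\<in>{1..d}. real i * (1 + \<delta>) < Re (\<Sum>j\<in>{1..i}. shift_first 1 s j)"
    using multL_domain_margin[OF s] by blast
  define T where "T = (\<lambda>n k. rising (s 1) k * Lterm d z (shift_first (Suc k) s) n)"
  define D where "D = (\<lambda>n. Lrest d z s n * (of_nat (n 1 - 1) powr (- s 1) - of_nat (n 1) powr (- s 1)))"
  have T_le: "cmod (T n k) \<le> weight_bound d \<delta> n * (rising_bound (cmod (s 1)) k / 2 ^ k)"
    if n: "n \<in> big_tuples d" for n k
  proof -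
    have nd: "n \<in> decreasing_tuples d" "2 \<le> n 1" using n by (auto simp: big_tuples_def)
    have "shift_first (Suc k) s = shift_first k (shift_first 1 s)" by (simp add: shift_first_add)
    then have "cmod (T n k) =
        cmod (rising (s 1) k) * (cmod (Lterm d z (shift_first 1 s) n) / real (n 1) ^ k)"
      using nd Lterm_shift_first[OF d, of n z k "shift_first 1 s"]
      by (simp add: T_def norm_mult norm_divide norm_power)
    also have "\<dots> \<le> rising_bound (cmod (s 1)) k * (weight_bound d \<delta> n / 2 ^ k)"
    proof (intro mult_mono norm_rising_le frac_le power_mono)
      show le: "cmod (Lterm d z (shift_first 1 s) n) \<le> weight_bound d \<delta> n"
        using \<delta> by (intro Lterm_bound[OF z nd(1)]) (auto intro: less_imp_le simp del: Re_sum)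
      show "0 \<le> weight_bound d \<delta> n" by (rule order_trans[OF norm_ge_zero le])
    qed (use nd in \<open>auto simp: rising_bound_nonneg\<close>)
    finally show ?thesis by (simp add: mult.commute)
  qed
  have "(\<lambda>(n, k). weight_bound d \<delta> n * (rising_bound (cmod (s 1)) k / 2 ^ k))
      summable_on big_tuples d \<times> UNIV"
  proof (rule summable_on_SigmaI)
    show "((\<lambda>k. case (n, k) of (n, k) \<Rightarrow> weight_bound d \<delta> n * (rising_bound (cmod (s 1)) k / 2 ^ k)) has_sum
      weight_bound d \<delta> n * (\<Sum>\<^sub>\<infinity>k. rising_bound (cmod (s 1)) k / 2 ^ k)) UNIV" for n
      unfolding prod.case
      by (rule has_sum_cmult_right[OF has_sum_infsum[OF rising_bound_summable[OF norm_ge_zero]]])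
    show "(\<lambda>n. weight_bound d \<delta> n * (\<Sum>\<^sub>\<infinity>k. rising_bound (cmod (s 1)) k / 2 ^ k)) summable_on big_tuples d"
      by (intro summable_on_cmult_left weight_bound_summable \<delta> big_tuples_subset)
  qed (auto simp: weight_bound_def intro!: mult_nonneg_nonneg prod_nonneg divide_nonneg_nonneg rising_bound_nonneg)
  then have T_summable: "(\<lambda>(n, k). T n k) summable_on big_tuples d \<times> UNIV"
    by (rule abs_summable_summable[OF summable_on_comparison_test]) (use T_le in auto)
  have T_has_sum: "(T n has_sum D n) UNIV" if n: "n \<in> big_tuples d" for n
  proof -
    have "T n k = Lrest d z s n * (rising (s 1) k * of_nat (n 1) powr (- s 1 - of_nat (Suc k)))" for k
    proof -
      have "- shift_first (Suc k) s 1 = - s 1 - of_nat (Suc k)" by (simp add: shift_first_def)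
      then show ?thesis unfolding T_def Lterm_Lrest[OF d] Lrest_shift_first by (simp only: mult_ac)
    qed
    then have T: "T n = (\<lambda>k. Lrest d z s n * (rising (s 1) k * of_nat (n 1) powr (- s 1 - of_nat (Suc k))))"
      by (rule ext)
    have "2 \<le> n 1" using n by (simp add: big_tuples_def)
    then show ?thesis
      unfolding D_def T by (rule has_sum_cmult_right[OF rising_translation_has_sum])
  qed
  have inner: "infsum (T n) UNIV = D n" if "n \<in> big_tuples d" for n
    using T_has_sum[OF that] by (rule infsumI)
  have "(\<lambda>n. infsum (T n) UNIV) summable_on big_tuples d"
    using T_summable by (rule summable_on_Sigma_banach)
  then show "D summable_on big_tuples d"
    by (rule summable_on_cong[THEN iffD1, rotated]) (rule inner)
  have "(\<Sum>\<^sub>\<infinity>k. rising (s 1) k * Ltail d z (shift_first (Suc k) s)) =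
      (\<Sum>\<^sub>\<infinity>k. \<Sum>\<^sub>\<infinity>n\<in>big_tuples d. T n k)"
    unfolding Ltail_def T_def by (simp only: infsum_cmult_right')
  also have "\<dots> = (\<Sum>\<^sub>\<infinity>n\<in>big_tuples d. \<Sum>\<^sub>\<infinity>k. T n k)"
    using T_summable by (rule infsum_swap_banach[symmetric])
  also have "\<dots> = infsum D (big_tuples d)" by (intro infsum_cong inner)
  finally show "(\<Sum>\<^sub>\<infinity>k. rising (s 1) k * Ltail d z (shift_first (Suc k) s)) = infsum D (big_tuples d)" .
qed

text \<open>For \<open>d = 0\<close> the missing next entry of a tuple counts as \<open>1\<close>, which makes \<open>big_tuples 1\<close> fit
  the pattern of the longer tuples.\<close>

definition head_entry :: "nat \<Rightarrow> (nat \<Rightarrow> nat) \<Rightarrow> nat" where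
  "head_entry d m = (if d = 0 then 1 else m 1)"

definition cons_tuple :: "nat \<Rightarrow> (nat \<Rightarrow> nat) \<Rightarrow> nat \<Rightarrow> nat \<Rightarrow> nat" where
  "cons_tuple d m n = (\<lambda>i\<in>{1..Suc d}. if i = 1 then n else m (i - 1))"

lemma head_entry_pos: "m \<in> decreasing_tuples d \<Longrightarrow> 1 \<le> head_entry d m"
  using decreasing_tuples_pos[of m d 1] by (auto simp: head_entry_def)

text \<open>Splitting off the largest entry turns a sum over tuples into an iterated sum with
  \<open>n 1\<close> innermost, running over all integers above the next entry. For
  \<open>d = 0\<close> the range becomes \<open>n > 1\<close>, exactly the condition in
  \<open>big_tuples\<close>.\<close>

lemma bij_betw_cons_tuple:
  "bij_betw (\<lambda>(m, n). cons_tuple d m n) (Sigma (decreasing_tuples d) (\<lambda>m. {head_entry d m<..}))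
     (big_tuples (Suc d))"
proof (rule bij_betw_byWitness[where f' = "\<lambda>n. (\<lambda>i\<in>{1..d}. n (Suc i), n 1)"])
  show "\<forall>a\<in>Sigma (decreasing_tuples d) (\<lambda>m. {head_entry d m<..}).
      (\<lambda>n. (\<lambda>i\<in>{1..d}. n (Suc i), n 1)) (case a of (m, n) \<Rightarrow> cons_tuple d m n) = a"
    by (auto simp: cons_tuple_def decreasing_tuples_def PiE_iff extensional_def restrict_def fun_eq_iff)
  show "\<forall>n\<in>big_tuples (Suc d). (case (\<lambda>i\<in>{1..d}. n (Suc i), n 1) of (m, n) \<Rightarrow> cons_tuple d m n) = n"
    by (auto simp: cons_tuple_def big_tuples_def decreasing_tuples_def PiE_iff extensional_def
        restrict_def fun_eq_iff)
  show "(\<lambda>n. (\<lambda>i\<in>{1..d}. n (Suc i), n 1)) ` big_tuples (Suc d) \<subseteq>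
      Sigma (decreasing_tuples d) (\<lambda>m. {head_entry d m<..})"
    by (auto simp: big_tuples_def decreasing_tuples_def PiE_iff head_entry_def)
  show "(\<lambda>(m, n). cons_tuple d m n) ` Sigma (decreasing_tuples d) (\<lambda>m. {head_entry d m<..}) \<subseteq>
      big_tuples (Suc d)"
  proof (rule image_subsetI)
    fix x assume "x \<in> Sigma (decreasing_tuples d) (\<lambda>m. {head_entry d m<..})"
    then obtain m n where x: "x = (m, n)" and m: "m \<in> decreasing_tuples d" and n: "n \<in> {head_entry d m<..}"
      by blast
    have n2: "2 \<le> n" using n head_entry_pos[OF m] by auto
    have less: "m j < n" if "j \<in> {1..d}" for j
    proof -
      have "m j \<le> m 1" using m that by (cases "j = 1") (auto simp: decreasing_tuples_def intro: less_imp_le)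
      then show ?thesis using n that by (auto simp: head_entry_def)
    qed
    have "cons_tuple d m n j < cons_tuple d m n i" if "i \<in> {1..Suc d}" "j \<in> {1..Suc d}" "i < j" for i j
    proof (cases "i = 1")
      case True
      moreover have "m (j - 1) < n" by (rule less) (use that True in auto)
      ultimately show ?thesis using that by (auto simp: cons_tuple_def)
    next
      case False
      then have "i - 1 \<in> {1..d}" "j - 1 \<in> {1..d}" "i - 1 < j - 1" using that by auto
      then have "m (j - 1) < m (i - 1)" using m unfolding decreasing_tuples_def by blast
      then show ?thesis using that False by (auto simp: cons_tuple_def)
    qed
    moreover have "cons_tuple d m n \<in> {1..Suc d} \<rightarrow>\<^sub>E {0<..}"
    proof -
      have "0 < m (i - 1)" if "i \<in> {1..Suc d}" "i \<noteq> 1" for i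
        by (rule decreasing_tuples_pos[OF m]) (use that in auto)
      then show ?thesis using n2 by (auto simp: cons_tuple_def)
    qed
    ultimately show "(case x of (m, n) \<Rightarrow> cons_tuple d m n) \<in> big_tuples (Suc d)"
      using n2 x by (auto simp: big_tuples_def decreasing_tuples_def cons_tuple_def)
  qed
qed

definition Lterm_tl :: "nat \<Rightarrow> (nat \<Rightarrow> complex) \<Rightarrow> (nat \<Rightarrow> complex) \<Rightarrow> (nat \<Rightarrow> nat) \<Rightarrow> complex" where
  "Lterm_tl d z s m = Lterm d (\<lambda>i. z (Suc i)) (\<lambda>i. s (Suc i)) m"

lemma cons_tuple_1 [simp]: "cons_tuple d m n 1 = n" "cons_tuple d m n (Suc 0) = n"
  by (simp_all add: cons_tuple_def)

lemma Lrest_cons_tuple: "Lrest (Suc d) z s (cons_tuple d m n) = z 1 ^ n * Lterm_tl d z s m"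
proof -
  have "(\<Prod>i\<in>{2..Suc d}. z i ^ cons_tuple d m n i / of_nat (cons_tuple d m n i) powr s i) =
     (\<Prod>i\<in>{Suc 1..Suc d}. z i ^ m (i - 1) / of_nat (m (i - 1)) powr s i)"
    by (intro prod.cong) (auto simp: cons_tuple_def)
  also have "\<dots> = Lterm_tl d z s m"
    by (subst prod.shift_bounds_cl_Suc_ivl) (simp add: Lterm_tl_def Lterm_def)
  finally show ?thesis by (simp add: Lrest_def)
qed

lemma infsum_big_tuples:
  fixes g :: "(nat \<Rightarrow> nat) \<Rightarrow> complex"
  assumes "g summable_on big_tuples (Suc d)"
  shows "(\<lambda>(m, n). g (cons_tuple d m n)) summable_on Sigma (decreasing_tuples d) (\<lambda>m. {head_entry d m<..})"
    and "infsum g (big_tuples (Suc d)) =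
      (\<Sum>\<^sub>\<infinity>m\<in>decreasing_tuples d. \<Sum>\<^sub>\<infinity>n\<in>{head_entry d m<..}. g (cons_tuple d m n))"
proof -
  have *: "(\<lambda>x. g (case x of (m, n) \<Rightarrow> cons_tuple d m n)) = (\<lambda>(m, n). g (cons_tuple d m n))"
    by auto
  show 1: "(\<lambda>(m, n). g (cons_tuple d m n)) summable_on Sigma (decreasing_tuples d) (\<lambda>m. {head_entry d m<..})"
    using assms summable_on_reindex_bij_betw[OF bij_betw_cons_tuple, of g d] by (simp add: *)
  show "infsum g (big_tuples (Suc d)) =
      (\<Sum>\<^sub>\<infinity>m\<in>decreasing_tuples d. \<Sum>\<^sub>\<infinity>n\<in>{head_entry d m<..}. g (cons_tuple d m n))"
    using infsum_Sigma'_banach[OF 1] infsum_reindex_bij_betw[OF bij_betw_cons_tuple, of g d]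
    by (simp add: *)
qed

lemma bij_betw_greaterThan: "bij_betw (\<lambda>j. h + 1 + j) UNIV {h<..}" for h :: nat
  by (rule bij_betw_byWitness[where f' = "\<lambda>n. n - h - 1"]) auto

text \<open>The partial sums telescope, and their far end tends to \<open>0\<close> since
  \<open>Re s > 0\<close>. This controls only the ordered sum; by summability the unordered sum has
  the same value instead of the default \<open>0\<close>.\<close>

lemma infsum_telescope_powr:
  assumes s: "Re s > 0"
    and sm: "(\<lambda>n. of_nat (n - 1) powr (- s) - of_nat n powr (- s) :: complex) summable_on {h<..}"
  shows "(\<Sum>\<^sub>\<infinity>n\<in>{h<..}. of_nat (n - 1) powr (- s) - of_nat n powr (- s)) = of_nat h powr (- s)"
proof -
  define f :: "nat \<Rightarrow> complex" where "f = (\<lambda>j. of_nat (h + j) powr (- s))"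
  let ?g = "\<lambda>n. of_nat (n - 1) powr (- s) - of_nat n powr (- s) :: complex"
  have eq: "?g (h + 1 + j) = f j - f (Suc j)" for j by (simp add: f_def ac_simps)
  have "f \<longlonglongrightarrow> 0"
    unfolding f_def
    by (rule tendsto_neg_powr_complex_of_nat) (use s in \<open>auto intro: filterlim_tendsto_add_at_top
        filterlim_add_const_nat_at_top simp: filterlim_subseq strict_mono_def\<close>)
  then have "(\<lambda>j. f j - f (Suc j)) sums (f 0 - 0)" by (rule telescope_sums')
  moreover have "(\<lambda>j. ?g (h + 1 + j)) summable_on UNIV"
    using sm summable_on_reindex_bij_betw[OF bij_betw_greaterThan, of ?g h] by blast
  then have "(\<lambda>j. f j - f (Suc j)) summable_on UNIV" by (simp only: eq)
  then have "(\<lambda>j. f j - f (Suc j)) sums (\<Sum>\<^sub>\<infinity>j. f j - f (Suc j))"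
    by (intro has_sum_imp_sums has_sum_infsum)
  ultimately have "(\<Sum>\<^sub>\<infinity>j. f j - f (Suc j)) = f 0" using sums_unique2 by fastforce
  moreover have "(\<Sum>\<^sub>\<infinity>n\<in>{h<..}. ?g n) = (\<Sum>\<^sub>\<infinity>j. ?g (h + 1 + j))"
    by (rule infsum_reindex_bij_betw[OF bij_betw_greaterThan, symmetric])
  ultimately show ?thesis by (simp only: eq) (simp add: f_def)
qed

text \<open>The diagonal \<open>n 1 = n 2\<close> of the series of depth \<open>d + 1\<close>,
  indexed by the tail \<open>m\<close> of the tuple. For \<open>d = 0\<close>, where there is no
  second entry, the convention in \<open>head_entry\<close> reduces it to
  \<open>z 1\<close>.\<close>

definition Ldiag :: "nat \<Rightarrow> (nat \<Rightarrow> complex) \<Rightarrow> (nat \<Rightarrow> complex) \<Rightarrow> complex" where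
  "Ldiag d z s = (\<Sum>\<^sub>\<infinity>m\<in>decreasing_tuples d.
     Lterm_tl d z s m * (z 1 ^ head_entry d m * of_nat (head_entry d m) powr (- s 1)))"

text \<open>With \<open>z 1 = 1\<close> nothing disturbs the telescoping in \<open>n 1\<close>: the
  inner sum collapses to the power of its lower end, the next entry, and only the diagonal
  remains.\<close>

lemma infsum_rising_trivial:
  assumes z: "bounded_partial_prods (Suc d) z" and s: "shift_first 1 s \<in> multL_domain (Suc d)"
    and z1: "z 1 = 1"
  shows "(\<Sum>\<^sub>\<infinity>k. rising (s 1) k * Ltail (Suc d) z (shift_first (Suc k) s)) = Ldiag d z s"
proof -
  have "1 \<in> {1..Suc d}" by simp
  then have "real 1 < Re (\<Sum>j\<in>{1..1}. shift_first 1 s j)" using s unfolding multL_domain_def by blast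
  then have s1: "Re (s 1) > 0" by (simp add: shift_first_def)
  let ?g = "\<lambda>n. of_nat (n - 1) powr (- s 1) - of_nat n powr (- s 1) :: complex"
  define D where "D = (\<lambda>n. Lrest (Suc d) z s n * ?g (n 1))"
  have D: "D (cons_tuple d m n) = Lterm_tl d z s m * ?g n" for m n
    unfolding D_def Lrest_cons_tuple cons_tuple_1 z1 by simp
  have Dsum: "D summable_on big_tuples (Suc d)"
    unfolding D_def by (rule summable_translation_difference[OF z _ s]) simp
  have "(\<Sum>\<^sub>\<infinity>k. rising (s 1) k * Ltail (Suc d) z (shift_first (Suc k) s)) = infsum D (big_tuples (Suc d))"
    unfolding D_def by (rule infsum_rising_Ltail[OF z _ s]) simp
  also have "\<dots> = (\<Sum>\<^sub>\<infinity>m\<in>decreasing_tuples d. \<Sum>\<^sub>\<infinity>n\<in>{head_entry d m<..}. Lterm_tl d z s m * ?g n)"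
    unfolding infsum_big_tuples(2)[OF Dsum] D ..
  also have "\<dots> = Ldiag d z s"
    unfolding Ldiag_def
  proof (rule infsum_cong)
    fix m assume m: "m \<in> decreasing_tuples d"
    let ?h = "head_entry d m"
    show "(\<Sum>\<^sub>\<infinity>n\<in>{?h<..}. Lterm_tl d z s m * ?g n) = Lterm_tl d z s m * (z 1 ^ ?h * of_nat ?h powr (- s 1))"
    \<comment> \<open>Summability of the differences is obtained by cancelling this factor; where it
      is \<open>0\<close>, both sides vanish.\<close>
    proof (cases "Lterm_tl d z s m = 0")
      case False
      have "(\<lambda>n. D (cons_tuple d m n)) summable_on {?h<..}"
        using summable_on_SigmaD1[OF infsum_big_tuples(1)[OF Dsum] m] .
      then have "?g summable_on {?h<..}"
        unfolding D using False by (subst (asm) summable_on_cmult_right') auto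
      then show ?thesis
        by (simp only: infsum_cmult_right' infsum_telescope_powr[OF s1] z1) simp
    qed simp
  qed
  finally show ?thesis .
qed

text \<open>Writing \<open>z ^ n = z * z ^ (n - 1)\<close> moves the first half of the sum to the
  range \<open>n \<ge> h\<close>, whose extra term \<open>n = h\<close> is the diagonal. The two
  halves are summed separately, which takes \<open>Re s > 1\<close>, whereas telescoping asked only
  for \<open>Re s > 0\<close>.\<close>

lemma infsum_twisted_difference:
  assumes z: "cmod z \<le> 1" and s: "Re s > 1" and h: "1 \<le> h"
  shows "(\<Sum>\<^sub>\<infinity>n\<in>{h<..}. z ^ n * (of_nat (n - 1) powr (- s) - of_nat n powr (- s))) =
    (z - 1) * (\<Sum>\<^sub>\<infinity>n\<in>{h<..}. z ^ n * of_nat n powr (- s)) + z * (z ^ h * of_nat h powr (- s))"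
proof -
  define a where "a = (\<lambda>n. z ^ n * of_nat n powr (- s))"
  have sm: "a summable_on A" for A
  proof (rule abs_summable_summable, rule summable_on_comparison_test)
    show "(\<lambda>n. real n powr (- (1 + (Re s - 1)))) summable_on A"
      by (rule summable_on_powr) (use s in auto)
    show "cmod (a n) \<le> real n powr (- (1 + (Re s - 1)))" for n
      using z by (auto simp: a_def norm_mult norm_power norm_powr_real_powr intro!: mult_left_le_one_le power_le_one)
  qed auto
  have Suc: "bij_betw Suc {h..} {h<..}"
    by (rule bij_betw_byWitness[where f' = "\<lambda>n. n - 1"]) auto
  have "(\<lambda>n. z * a (n - 1)) summable_on {h<..}"
    using summable_on_reindex_bij_betw[OF Suc, of "\<lambda>n. z * a (n - 1)"] summable_on_cmult_right[OF sm[of "{h..}"], of z]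
    by simp
  moreover have "z ^ n * (of_nat (n - 1) powr (- s) - of_nat n powr (- s)) = z * a (n - 1) - a n"
    if "n \<in> {h<..}" for n
    using that h by (cases n) (auto simp: a_def algebra_simps)
  then have "(\<Sum>\<^sub>\<infinity>n\<in>{h<..}. z ^ n * (of_nat (n - 1) powr (- s) - of_nat n powr (- s))) =
      (\<Sum>\<^sub>\<infinity>n\<in>{h<..}. z * a (n - 1) - a n)"
    by (rule infsum_cong)
  ultimately have "(\<Sum>\<^sub>\<infinity>n\<in>{h<..}. z ^ n * (of_nat (n - 1) powr (- s) - of_nat n powr (- s))) =
      (\<Sum>\<^sub>\<infinity>n\<in>{h<..}. z * a (n - 1)) - infsum a {h<..}"
    using has_sum_diff[OF has_sum_infsum has_sum_infsum[OF sm]] by (metis (no_types) infsumI)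
  also have "(\<Sum>\<^sub>\<infinity>n\<in>{h<..}. z * a (n - 1)) = z * infsum a {h..}"
    using infsum_reindex_bij_betw[OF Suc, of "\<lambda>n. z * a (n - 1)"] by (auto simp: infsum_cmult_right')
  also have "{h..} = insert h {h<..}" by auto
  also have "infsum a (insert h {h<..}) = a h + infsum a {h<..}"
    by (rule infsum_insert[OF sm]) simp
  finally show ?thesis by (simp add: a_def algebra_simps)
qed

lemma infsum_rising_nontrivial:
  assumes z: "bounded_partial_prods (Suc d) z" and s: "s \<in> multL_domain (Suc d)"
  shows "(\<Sum>\<^sub>\<infinity>k. rising (s 1) k * Ltail (Suc d) z (shift_first (Suc k) s)) =
    (z 1 - 1) * Ltail (Suc d) z s + z 1 * Ldiag d z s"
proof -
  have s': "shift_first 1 s \<in> multL_domain (Suc d)" by (rule shift_first_multL_domain[OF s]) simp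
  have 1: "1 \<in> {1..Suc d}" by simp
  then have "real 1 < Re (\<Sum>j\<in>{1..1}. s j)" using s unfolding multL_domain_def by blast
  then have s1: "Re (s 1) > 1" by simp
  have "cmod (\<Prod>j\<in>{1..1}. z j) \<le> 1" using 1 z unfolding bounded_partial_prods_def by blast
  then have z1: "cmod (z 1) \<le> 1" by simp
  let ?g = "\<lambda>n. z 1 ^ n * (of_nat (n - 1) powr (- s 1) - of_nat n powr (- s 1)) :: complex"
  let ?a = "\<lambda>n. z 1 ^ n * of_nat n powr (- s 1)"
  define D where "D = (\<lambda>n. Lrest (Suc d) z s n * (of_nat (n 1 - 1) powr (- s 1) - of_nat (n 1) powr (- s 1)))"
  have D: "D (cons_tuple d m n) = Lterm_tl d z s m * ?g n" for m n
    unfolding D_def Lrest_cons_tuple by simp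
  have Lt: "Lterm (Suc d) z s (cons_tuple d m n) = Lterm_tl d z s m * ?a n" for m n
    by (subst Lterm_Lrest) (simp_all add: Lrest_cons_tuple)
  have Dsum: "D summable_on big_tuples (Suc d)"
    unfolding D_def by (rule summable_translation_difference[OF z _ s']) simp
  have Lsum: "Lterm (Suc d) z s summable_on big_tuples (Suc d)"
    by (rule Lterm_summable[OF z s big_tuples_subset])
  define I where "I = (\<lambda>m. \<Sum>\<^sub>\<infinity>n\<in>{head_entry d m<..}. D (cons_tuple d m n))"
  define S where "S = (\<lambda>m. \<Sum>\<^sub>\<infinity>n\<in>{head_entry d m<..}. Lterm (Suc d) z s (cons_tuple d m n))"
  define X where "X = (\<lambda>m. Lterm_tl d z s m * ?a (head_entry d m))"
  have IS: "I m = (z 1 - 1) * S m + z 1 * X m" if m: "m \<in> decreasing_tuples d" for m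
    unfolding I_def S_def X_def D Lt infsum_cmult_right'
      infsum_twisted_difference[OF z1 s1 head_entry_pos[OF m]]
    by (simp add: algebra_simps)
  have I: "I summable_on decreasing_tuples d" "infsum I (decreasing_tuples d) = infsum D (big_tuples (Suc d))"
    unfolding I_def using infsum_big_tuples[OF Dsum] summable_on_Sigma_banach by auto
  have S: "S summable_on decreasing_tuples d" "infsum S (decreasing_tuples d) = Ltail (Suc d) z s"
    unfolding S_def Ltail_def using infsum_big_tuples[OF Lsum] summable_on_Sigma_banach by auto
  have "(\<Sum>\<^sub>\<infinity>k. rising (s 1) k * Ltail (Suc d) z (shift_first (Suc k) s)) = infsum D (big_tuples (Suc d))"
    unfolding D_def by (rule infsum_rising_Ltail[OF z _ s']) simp
  also have "\<dots> = infsum I (decreasing_tuples d)" by (simp only: I)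
  finally have total: "(\<Sum>\<^sub>\<infinity>k. rising (s 1) k * Ltail (Suc d) z (shift_first (Suc k) s)) =
    infsum I (decreasing_tuples d)" .
  \<comment> \<open>The diagonal is summed as the difference of two families already known to be
    summable, so it needs no estimate of its own.\<close>
  have "((\<lambda>m. I m - (z 1 - 1) * S m) has_sum
      (infsum I (decreasing_tuples d) - (z 1 - 1) * infsum S (decreasing_tuples d))) (decreasing_tuples d)"
    by (intro has_sum_diff has_sum_cmult_right has_sum_infsum I S)
  then have "((\<lambda>m. z 1 * X m) has_sum
      (infsum I (decreasing_tuples d) - (z 1 - 1) * infsum S (decreasing_tuples d))) (decreasing_tuples d)"
    by (rule has_sum_cong[THEN iffD1, rotated]) (simp add: IS)
  then have "z 1 * Ldiag d z s = infsum I (decreasing_tuples d) - (z 1 - 1) * Ltail (Suc d) z s"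
    unfolding Ldiag_def X_def[symmetric] S(2)[symmetric] infsum_cmult_right'[symmetric]
    using infsumI by blast
  then show ?thesis using total by (simp add: algebra_simps)
qed

lemma Ldiag_0: "Ldiag 0 z s = z 1"
proof -
  have "decreasing_tuples 0 = {\<lambda>_. undefined}" by (auto simp: decreasing_tuples_def)
  then show ?thesis by (simp add: Ldiag_def Lterm_tl_def Lterm_def head_entry_def)
qed

text \<open>On the diagonal the first two entries coincide, so their characters multiply and their
  exponents add. The offset \<open>c\<close> is \<open>- 1\<close> when the identity is evaluated at
  \<open>s\<close> moved back by one, and \<open>0\<close> otherwise.\<close>

lemma Ldiag_merge:
  assumes d: "1 \<le> d"
  shows "Ldiag d z (s(1 := s 1 + c)) =
    (\<Sum>\<^sub>\<infinity>m\<in>decreasing_tuples d.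
       Lterm d (\<lambda>i. if i = 1 then z 1 * z 2 else z (Suc i)) (merge_first (Suc d) c s) m)"
  unfolding Ldiag_def
proof (rule infsum_cong)
  fix m assume "m \<in> decreasing_tuples d"
  then have m: "0 < m 1" using decreasing_tuples_pos[of m d 1] d by auto
  have *: "{1..d} = insert 1 {2..d}" using d by auto
  let ?P = "\<Prod>i\<in>{2..d}. z (Suc i) ^ m i / of_nat (m i) powr s (Suc i)"
  have "Lterm d (\<lambda>i. if i = 1 then z 1 * z 2 else z (Suc i)) (merge_first (Suc d) c s) m =
     (z 1 * z 2) ^ m 1 / of_nat (m 1) powr (s 1 + s 2 + c) *
     (\<Prod>i\<in>{2..d}. (if i = 1 then z 1 * z 2 else z (Suc i)) ^ m i / of_nat (m i) powr merge_first (Suc d) c s i)"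
    unfolding Lterm_def * using d by (simp add: merge_first_def)
  also have "(\<Prod>i\<in>{2..d}. (if i = 1 then z 1 * z 2 else z (Suc i)) ^ m i / of_nat (m i) powr merge_first (Suc d) c s i) = ?P"
    by (rule prod.cong) (auto simp: merge_first_def)
  finally have 1: "Lterm d (\<lambda>i. if i = 1 then z 1 * z 2 else z (Suc i)) (merge_first (Suc d) c s) m =
     (z 1 * z 2) ^ m 1 / of_nat (m 1) powr (s 1 + s 2 + c) * ?P" .
  have "(\<Prod>i\<in>{2..d}. z (Suc i) ^ m i / of_nat (m i) powr (s(1 := s 1 + c)) (Suc i)) = ?P"
    by (rule prod.cong) auto
  then have 2: "Lterm_tl d z (s(1 := s 1 + c)) m = z 2 ^ m 1 / of_nat (m 1) powr s 2 * ?P"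
    unfolding Lterm_tl_def Lterm_def * by (simp add: numeral_2_eq_2)
  have "(of_nat (m 1) :: complex) powr (s 1 + s 2 + c) =
     of_nat (m 1) powr s 2 * of_nat (m 1) powr (s 1 + c)"
    by (simp add: powr_add mult_ac)
  then show "Lterm_tl d z (s(1 := s 1 + c)) m *
        (z 1 ^ head_entry d m * of_nat (head_entry d m) powr (- (s(1 := s 1 + c)) 1)) =
     Lterm d (\<lambda>i. if i = 1 then z 1 * z 2 else z (Suc i)) (merge_first (Suc d) c s) m"
    unfolding 1 2 using d
    by (simp add: head_entry_def powr_minus power_mult_distrib divide_inverse mult_ac
          del: minus_add_distrib)
qed

section \<open>Meromorphic continuation\<close>

lemma infsum_nat_Suc:
  fixes f :: "nat \<Rightarrow> complex"
  assumes "f summable_on UNIV"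
  shows "infsum f UNIV = f 0 + (\<Sum>\<^sub>\<infinity>k. f (Suc k))"
proof -
  have "UNIV = insert 0 (range Suc)" using not0_implies_Suc by auto
  then have "infsum f UNIV = infsum f (insert 0 (range Suc))" by simp
  also have "\<dots> = f 0 + infsum f (range Suc)"
    by (rule infsum_insert) (use assms in \<open>auto intro: summable_on_subset_banach\<close>)
  also have "infsum f (range Suc) = (\<Sum>\<^sub>\<infinity>k. f (Suc k))"
    by (subst infsum_reindex) (auto simp: o_def)
  finally show ?thesis .
qed

lemma summable_rising_mult:
  assumes "\<And>k. N \<le> k \<Longrightarrow> cmod (G k) \<le> C / 2 ^ k"
  shows "(\<lambda>k. rising w k * G k) summable_on UNIV"
proof (rule norm_summable_imp_summable_on, rule summable_comparison_test'[where N = N])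
  have "summable (\<lambda>k. rising_bound (cmod w) k / 2 ^ k)"
    by (rule summable_on_imp_summable[OF rising_bound_summable]) simp
  then show "summable (\<lambda>k. rising_bound (cmod w) k / 2 ^ k * C)" by (rule summable_mult2)
  fix k assume "N \<le> k"
  then have "cmod (rising w k * G k) \<le> rising_bound (cmod w) k * (C / 2 ^ k)"
    unfolding norm_mult using assms by (intro mult_mono norm_rising_le) (auto simp: rising_bound_nonneg)
  then show "norm (cmod (rising w k * G k)) \<le> rising_bound (cmod w) k / 2 ^ k * C" by simp
qed

text \<open>The later coefficients contain \<open>w - 1\<close> too; dividing it out leaves
  \<open>rising w k\<close> with the weight \<open>1 / (k + 2)\<close>, the quotient of the two
  factorials.\<close>

lemma rising_pred:
  "rising (w - 1) (Suc k) = (w - 1) * (rising w k / of_nat (Suc (Suc k)))"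
proof -
  have "pochhammer (w - 1) (Suc (Suc k)) = (w - 1) * pochhammer w (Suc k)"
    by (subst pochhammer_rec) simp
  then show ?thesis unfolding rising_def fact_Suc[of "Suc k"] by simp
qed

lemma rising_0: "rising w 0 = w"
  by (simp add: rising_def)

lemma holomorphic_on_rising: "(\<lambda>w. rising w k) holomorphic_on A"
  unfolding rising_def pochhammer_prod by (intro holomorphic_intros) auto

lemma holomorphic_Cn_rising:
  assumes "openin (cspace r) V"
  shows "holomorphic_Cn r V (\<lambda>s. rising (s 1 + c) k)"
  by (rule holomorphic_Cn_compose1[OF _ holomorphic_on_rising, of r V "\<lambda>s. s 1 + c"])
     (intro holomorphic_Cn_add holomorphic_Cn_coord holomorphic_Cn_const assms)

lemma holomorphic_Cn_Ltail:
  "bounded_partial_prods d z \<Longrightarrow> holomorphic_Cn d (multL_domain d) (Ltail d z)"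
  using holomorphic_Cn_Lterm_sum[OF _ big_tuples_subset] by (simp add: Ltail_def[abs_def])

text \<open>Common form of both recursions. The weights \<open>\<beta>\<close> are
  \<open>- 1 / (k + 2)\<close> if \<open>z 1 = 1\<close> and the constant
  \<open>1 / (z 1 - 1)\<close> otherwise; being bounded, they leave the decay intact.\<close>

lemma Ltail_continuation:
  fixes \<beta> :: "nat \<Rightarrow> complex"
  assumes z: "bounded_partial_prods r z" and r: "1 \<le> r"
    and A: "holomorphic_Cn r (Cn r) A" and \<beta>: "\<And>k. cmod (\<beta> k) \<le> M"
    and rec: "\<And>s. s \<in> multL_domain r \<Longrightarrow> Ltail r z s = A s / gamma_factor r s +
       (\<Sum>\<^sub>\<infinity>k. rising (s 1) k * \<beta> k * Ltail r z (shift_first (Suc k) s))"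
  shows "\<exists>H. holomorphic_Cn r (Cn r) H \<and>
    (\<forall>s\<in>multL_domain r. H s = gamma_factor r s * Ltail r z s) \<and>
    (\<forall>s\<in>Cn r. gamma_factor r s \<noteq> 0 \<longrightarrow>
       H s / gamma_factor r s = A s / gamma_factor r s +
       (\<Sum>\<^sub>\<infinity>k. rising (s 1) k * \<beta> k *
          (H (shift_first (Suc k) s) / gamma_factor r (shift_first (Suc k) s))))"
proof (rule translation_continuation[OF r holomorphic_Cn_Ltail[OF z] holomorphic_Cn_gamma_factor _ A])
  have Cn: "openin (cspace r) (Cn r)" by simp
  show "holomorphic_Cn r (Cn r) (\<lambda>s. \<Prod>i\<in>{1..r}. (\<Sum>j\<in>{1..i}. s j) + - of_nat i)"
    by (intro holomorphic_Cn_prod holomorphic_Cn_partial_sum Cn)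
  show "holomorphic_Cn r (Cn r) (\<lambda>s. rising (s 1) k * \<beta> k)" for k
    using holomorphic_Cn_rising[OF Cn, of 0 k] by (intro holomorphic_Cn_mult holomorphic_Cn_const Cn) simp
  show "gamma_factor r s =
     (\<Prod>i\<in>{1..r}. (\<Sum>j\<in>{1..i}. s j) + - of_nat i) * gamma_factor r (shift_first 1 s)" for s
    by (rule gamma_factor_shift_1)
  have M: "0 \<le> M" using order_trans[OF norm_ge_zero \<beta>] .
  fix R :: real assume R: "R > 0"
  obtain N C where C: "C \<ge> 0" and N: "\<And>s k. s \<in> coord_box r R \<Longrightarrow> N \<le> k \<Longrightarrow> shift_first k s \<in> multL_domain r"
    "\<And>s k. s \<in> coord_box r R \<Longrightarrow> N \<le> k \<Longrightarrow> cmod (Ltail r z (shift_first k s)) \<le> C / 2 ^ k"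
    using Ltail_decay[OF z r R] by metis
  show "\<exists>N g. g summable_on UNIV \<and> (\<forall>s\<in>coord_box r R. \<forall>k\<ge>N.
      shift_first (Suc k) s \<in> multL_domain r \<and>
      cmod (rising (s 1) k * \<beta> k * Ltail r z (shift_first (Suc k) s)) \<le> g k)"
  proof (intro exI conjI ballI allI impI)
    show "(\<lambda>k. rising_bound R k / 2 ^ k * (M * C)) summable_on UNIV"
      using R by (intro summable_on_cmult_left rising_bound_summable) simp
    fix s k assume s: "s \<in> coord_box r R" and k: "N \<le> k"
    show "shift_first (Suc k) s \<in> multL_domain r" using N(1)[OF s] k by simp
    have "cmod (Ltail r z (shift_first (Suc k) s)) \<le> C / 2 ^ Suc k" using N(2)[OF s, of "Suc k"] k by simp
    also have "\<dots> \<le> C / 2 ^ k" using C by (intro divide_left_mono) auto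
    finally have L: "cmod (Ltail r z (shift_first (Suc k) s)) \<le> C / 2 ^ k" .
    have "cmod (s 1) \<le> R" using s r by (auto simp: coord_box_def intro: less_imp_le)
    then have "cmod (rising (s 1) k * \<beta> k * Ltail r z (shift_first (Suc k) s)) \<le>
       rising_bound R k * M * (C / 2 ^ k)"
      unfolding norm_mult
      by (intro mult_mono norm_rising_le \<beta> L) (use R M in \<open>auto simp: rising_bound_nonneg\<close>)
    then show "cmod (rising (s 1) k * \<beta> k * Ltail r z (shift_first (Suc k) s)) \<le>
       rising_bound R k / 2 ^ k * (M * C)" by simp
  qed
next
  fix s assume s: "s \<in> multL_domain r"
  have "(\<Sum>\<^sub>\<infinity>k. rising (s 1) k * \<beta> k * (gamma_factor r s * Ltail r z (shift_first (Suc k) s))) =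
     gamma_factor r s * (\<Sum>\<^sub>\<infinity>k. rising (s 1) k * \<beta> k * Ltail r z (shift_first (Suc k) s))"
    unfolding infsum_cmult_right'[symmetric] by (simp only: mult_ac)
  then show "gamma_factor r s * Ltail r z s = A s +
     (\<Sum>\<^sub>\<infinity>k. rising (s 1) k * \<beta> k * (gamma_factor r s * Ltail r z (shift_first (Suc k) s)))"
    using gamma_factor_nonzero[OF s] by (subst rec[OF s]) (simp add: distrib_left)
qed

text \<open>The term \<open>k = 0\<close> is \<open>(w - 1) * G 0\<close>, and by
  \<open>rising_pred\<close> the rest has the same factor. The sign is put into the weights so that
  they can serve as \<open>\<beta>\<close>.\<close>

lemma rising_sum_split:
  assumes "\<And>k. N \<le> k \<Longrightarrow> cmod (G k) \<le> C / 2 ^ k"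
  shows "(\<Sum>\<^sub>\<infinity>k. rising (w - 1) k * G k) =
    (w - 1) * (G 0 - (\<Sum>\<^sub>\<infinity>k. rising w k * (- 1 / of_nat (Suc (Suc k))) * G (Suc k)))"
proof -
  have "(\<Sum>\<^sub>\<infinity>k. rising (w - 1) k * G k) = (w - 1) * G 0 + (\<Sum>\<^sub>\<infinity>k. rising (w - 1) (Suc k) * G (Suc k))"
    by (subst infsum_nat_Suc[OF summable_rising_mult[OF assms]]) (simp_all add: rising_0)
  also have "(\<lambda>k. rising (w - 1) (Suc k) * G (Suc k)) =
     (\<lambda>k. (- (w - 1)) * (rising w k * (- 1 / of_nat (Suc (Suc k))) * G (Suc k)))"
    unfolding rising_pred by (rule ext) (simp del: minus_diff_eq)
  finally show ?thesis
    unfolding infsum_cmult_right' by (simp only: right_diff_distrib mult_minus_left add_uminus_conv_diff)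
qed

lemma decay_at:
  assumes "\<And>R. R > 0 \<Longrightarrow> \<exists>N C. C \<ge> 0 \<and> (\<forall>s\<in>coord_box d R. \<forall>k\<ge>N.
      shift_first k s \<in> multL_domain d \<and> cmod (F (shift_first k s)) \<le> C / 2 ^ k)"
    and "s \<in> Cn d"
  obtains N C where "\<And>k. N \<le> k \<Longrightarrow> cmod (F (shift_first k s)) \<le> C / 2 ^ k"
    and "C \<ge> 0"
proof -
  obtain R where "R > 0" "s \<in> coord_box d R" using in_coord_box[OF assms(2)] by blast
  then show thesis using assms(1)[of R] that by metis
qed

text \<open>The estimate looks only at translates that already lie in the domain, so a continuation
  inherits it from the series.\<close>

lemma decay_cong:
  assumes "\<exists>N C. C \<ge> 0 \<and> (\<forall>s\<in>coord_box d R. \<forall>k\<ge>N.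
      shift_first k s \<in> multL_domain d \<and> cmod (G (shift_first k s)) \<le> C / 2 ^ k)"
    and "\<And>s. s \<in> multL_domain d \<Longrightarrow> F s = G s"
  shows "\<exists>N C. C \<ge> 0 \<and> (\<forall>s\<in>coord_box d R. \<forall>k\<ge>N.
      shift_first k s \<in> multL_domain d \<and> cmod (F (shift_first k s)) \<le> C / 2 ^ k)"
  using assms by (metis (no_types, lifting))

lemma gamma_quotient_eq:
  "\<forall>s\<in>multL_domain r. H s = gamma_factor r s * L s \<Longrightarrow> s \<in> multL_domain r \<Longrightarrow>
    H s / gamma_factor r s = L s"
  using gamma_factor_nonzero by simp

text \<open>The identity at \<open>s\<close> moved back by one has the untranslated value in its
  term \<open>k = 0\<close>, with coefficient \<open>s 1 - 1\<close>. Dividing by it gives the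
  recursion, provided that the diagonal, cleared of poles, is divisible by \<open>s 1 - 1\<close>;
  \<open>A\<close> is that quotient.\<close>

lemma continuation_trivial:
  assumes z: "bounded_partial_prods (Suc d) z" "z 1 = 1"
    and A: "holomorphic_Cn (Suc d) (Cn (Suc d)) A"
    and AL: "\<And>s. s \<in> multL_domain (Suc d) \<Longrightarrow>
      (s 1 - 1) * A s = gamma_factor (Suc d) s * Ldiag d z (s(1 := s 1 - 1))"
  shows "\<exists>H. holomorphic_Cn (Suc d) (Cn (Suc d)) H \<and>
    (\<forall>s\<in>multL_domain (Suc d). H s = gamma_factor (Suc d) s * Ltail (Suc d) z s) \<and>
    (\<forall>s\<in>Cn (Suc d). gamma_factor (Suc d) s \<noteq> 0 \<longrightarrow>
       (\<Sum>\<^sub>\<infinity>k. rising (s 1 - 1) k *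
          (H (shift_first k s) / gamma_factor (Suc d) (shift_first k s))) =
       (s 1 - 1) * A s / gamma_factor (Suc d) s)"
proof -
  let ?r = "Suc d"
  have r: "1 \<le> ?r" by simp
  define \<beta> :: "nat \<Rightarrow> complex" where "\<beta> = (\<lambda>k. - 1 / of_nat (Suc (Suc k)))"
  have \<beta>: "cmod (\<beta> k) \<le> 1" for k
    unfolding \<beta>_def norm_divide norm_of_nat by (simp add: divide_le_eq)
  have "\<exists>H. holomorphic_Cn ?r (Cn ?r) H \<and>
    (\<forall>s\<in>multL_domain ?r. H s = gamma_factor ?r s * Ltail ?r z s) \<and>
    (\<forall>s\<in>Cn ?r. gamma_factor ?r s \<noteq> 0 \<longrightarrow>
       H s / gamma_factor ?r s = A s / gamma_factor ?r s +
       (\<Sum>\<^sub>\<infinity>k. rising (s 1) k * \<beta> k *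
          (H (shift_first (Suc k) s) / gamma_factor ?r (shift_first (Suc k) s))))"
  proof (rule Ltail_continuation[OF z(1) _ A \<beta>])
    fix s assume s: "s \<in> multL_domain ?r"
    have sC: "s \<in> Cn ?r" using s multL_domain_subset by blast
    have "1 \<in> {1..?r}" by simp
    then have "real 1 < Re (\<Sum>j\<in>{1..1}. s j)" using s unfolding multL_domain_def by blast
    \<comment> \<open>On the domain \<open>Re (s 1) > 1\<close>, so the division is harmless;
      elsewhere the factor is only multiplied back.\<close>
    then have s1: "s 1 - 1 \<noteq> 0" by auto
    define t where "t = s(1 := s 1 - 1)"
    have t: "shift_first (Suc k) t = shift_first k s" "t 1 = s 1 - 1" for k
      by (simp_all add: t_def shift_first_def)
    have "shift_first 1 t \<in> multL_domain ?r" using t(1)[of 0] s by simp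
    from infsum_rising_trivial[OF z(1) this z(2)]
    have 1: "(\<Sum>\<^sub>\<infinity>k. rising (s 1 - 1) k * Ltail ?r z (shift_first k s)) = Ldiag d z t"
      by (simp only: t)
    obtain N C where "\<And>k. N \<le> k \<Longrightarrow> cmod (Ltail ?r z (shift_first k s)) \<le> C / 2 ^ k"
      using decay_at[OF Ltail_decay[OF z(1) r] sC] by metis
    from rising_sum_split[where G = "\<lambda>k. Ltail ?r z (shift_first k s)", OF this]
    have 2: "(\<Sum>\<^sub>\<infinity>k. rising (s 1 - 1) k * Ltail ?r z (shift_first k s)) =
       (s 1 - 1) * (Ltail ?r z s - (\<Sum>\<^sub>\<infinity>k. rising (s 1) k * \<beta> k * Ltail ?r z (shift_first (Suc k) s)))"
      by (simp only: \<beta>_def shift_first_0)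
    have "Ldiag d z t = (s 1 - 1) * (A s / gamma_factor ?r s)"
      using AL[OF s] gamma_factor_nonzero[OF s] by (simp add: t_def)
    then have "(s 1 - 1) * (Ltail ?r z s - (\<Sum>\<^sub>\<infinity>k. rising (s 1) k * \<beta> k * Ltail ?r z (shift_first (Suc k) s))) =
       (s 1 - 1) * (A s / gamma_factor ?r s)"
      by (rule trans[OF trans[OF 2[symmetric] 1]])
    then have "Ltail ?r z s - (\<Sum>\<^sub>\<infinity>k. rising (s 1) k * \<beta> k * Ltail ?r z (shift_first (Suc k) s)) =
       A s / gamma_factor ?r s"
      by (rule mult_left_cancel[OF s1, THEN iffD1])
    then show "Ltail ?r z s = A s / gamma_factor ?r s +
       (\<Sum>\<^sub>\<infinity>k. rising (s 1) k * \<beta> k * Ltail ?r z (shift_first (Suc k) s))"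
      by (simp only: diff_eq_eq)
  qed simp
  then obtain H where H: "holomorphic_Cn ?r (Cn ?r) H"
      "\<forall>s\<in>multL_domain ?r. H s = gamma_factor ?r s * Ltail ?r z s"
    and HF: "\<And>s. s \<in> Cn ?r \<Longrightarrow> gamma_factor ?r s \<noteq> 0 \<Longrightarrow>
       H s / gamma_factor ?r s = A s / gamma_factor ?r s +
       (\<Sum>\<^sub>\<infinity>k. rising (s 1) k * \<beta> k *
          (H (shift_first (Suc k) s) / gamma_factor ?r (shift_first (Suc k) s)))"
    by blast
  define F where "F = (\<lambda>s. H s / gamma_factor ?r s)"
  have "(\<Sum>\<^sub>\<infinity>k. rising (s 1 - 1) k * F (shift_first k s)) = (s 1 - 1) * A s / gamma_factor ?r s"
    if s: "s \<in> Cn ?r" "gamma_factor ?r s \<noteq> 0" for s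
  proof -
    obtain N C where "\<And>k. N \<le> k \<Longrightarrow> cmod (F (shift_first k s)) \<le> C / 2 ^ k"
      using decay_at[OF decay_cong[OF Ltail_decay[OF z(1) r] gamma_quotient_eq[OF H(2)]] s(1)]
      unfolding F_def by metis
    from rising_sum_split[where G = "\<lambda>k. F (shift_first k s)", OF this]
    have "(\<Sum>\<^sub>\<infinity>k. rising (s 1 - 1) k * F (shift_first k s)) =
       (s 1 - 1) * (F s - (\<Sum>\<^sub>\<infinity>k. rising (s 1) k * \<beta> k * F (shift_first (Suc k) s)))"
      by (simp only: \<beta>_def shift_first_0)
    also have "F s - (\<Sum>\<^sub>\<infinity>k. rising (s 1) k * \<beta> k * F (shift_first (Suc k) s)) = A s / gamma_factor ?r s"
      unfolding diff_eq_eq F_def by (rule HF[OF s])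
    finally show ?thesis by simp
  qed
  then show ?thesis using H unfolding F_def by blast
qed

lemma continuation_nontrivial:
  assumes z: "bounded_partial_prods (Suc d) z" "z 1 \<noteq> 1"
    and A: "holomorphic_Cn (Suc d) (Cn (Suc d)) A"
    and AL: "\<And>s. s \<in> multL_domain (Suc d) \<Longrightarrow> A s = gamma_factor (Suc d) s * Ldiag d z s"
  shows "\<exists>H. holomorphic_Cn (Suc d) (Cn (Suc d)) H \<and>
    (\<forall>s\<in>multL_domain (Suc d). H s = gamma_factor (Suc d) s * Ltail (Suc d) z s) \<and>
    (\<forall>s\<in>Cn (Suc d). gamma_factor (Suc d) s \<noteq> 0 \<longrightarrow>
       (\<Sum>\<^sub>\<infinity>k. rising (s 1) k *
          (H (shift_first (Suc k) s) / gamma_factor (Suc d) (shift_first (Suc k) s))) =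
       z 1 * (A s / gamma_factor (Suc d) s) + (z 1 - 1) * (H s / gamma_factor (Suc d) s))"
proof -
  let ?r = "Suc d"
  define \<alpha> where "\<alpha> = - z 1 / (z 1 - 1)"
  define \<beta> where "\<beta> = 1 / (z 1 - 1)"
  have sum_eq: "(\<Sum>\<^sub>\<infinity>k. rising w k * \<beta> * G k) = \<beta> * (\<Sum>\<^sub>\<infinity>k. rising w k * G k)" for w G
    unfolding infsum_cmult_right'[symmetric] by (simp only: mult_ac)
  \<comment> \<open>This equivalence is used in both directions: to derive the recursion on the
    domain, and to turn the continued recursion back into the identity.\<close>
  have solve: "x = \<alpha> * a + \<beta> * t \<longleftrightarrow> t = z 1 * a + (z 1 - 1) * x" for x a t
  proof -
    have "\<alpha> * a + \<beta> * t = (t - z 1 * a) / (z 1 - 1)"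
      by (simp add: \<alpha>_def \<beta>_def diff_divide_distrib)
    moreover have "x = (t - z 1 * a) / (z 1 - 1) \<longleftrightarrow> t = z 1 * a + (z 1 - 1) * x"
      using z(2) by (auto simp: eq_divide_eq algebra_simps)
    ultimately show ?thesis by (simp only:)
  qed
  have "\<exists>H. holomorphic_Cn ?r (Cn ?r) H \<and>
    (\<forall>s\<in>multL_domain ?r. H s = gamma_factor ?r s * Ltail ?r z s) \<and>
    (\<forall>s\<in>Cn ?r. gamma_factor ?r s \<noteq> 0 \<longrightarrow>
       H s / gamma_factor ?r s = (\<alpha> * A s) / gamma_factor ?r s +
       (\<Sum>\<^sub>\<infinity>k. rising (s 1) k * \<beta> *
          (H (shift_first (Suc k) s) / gamma_factor ?r (shift_first (Suc k) s))))"
  proof (rule Ltail_continuation[OF z(1)])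
    show "holomorphic_Cn ?r (Cn ?r) (\<lambda>s. \<alpha> * A s)"
      by (intro holomorphic_Cn_mult A holomorphic_Cn_const) simp
    fix s assume s: "s \<in> multL_domain ?r"
    have "(\<alpha> * A s) / gamma_factor ?r s = \<alpha> * Ldiag d z s"
      using AL[OF s] gamma_factor_nonzero[OF s] by simp
    moreover have "Ltail ?r z s = \<alpha> * Ldiag d z s +
        \<beta> * (\<Sum>\<^sub>\<infinity>k. rising (s 1) k * Ltail ?r z (shift_first (Suc k) s))"
      unfolding solve using infsum_rising_nontrivial[OF z(1) s] by (simp add: add.commute)
    ultimately show "Ltail ?r z s = (\<alpha> * A s) / gamma_factor ?r s +
       (\<Sum>\<^sub>\<infinity>k. rising (s 1) k * \<beta> * Ltail ?r z (shift_first (Suc k) s))"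
      by (simp only: sum_eq)
  qed auto
  then show ?thesis
    unfolding sum_eq times_divide_eq_right[of \<alpha>, symmetric] solve .
qed

section \<open>Induction on the depth\<close>

definition Lfull :: "nat \<Rightarrow> (nat \<Rightarrow> complex) \<Rightarrow> (nat \<Rightarrow> complex) \<Rightarrow> complex" where
  "Lfull d z s = (\<Sum>\<^sub>\<infinity>n\<in>decreasing_tuples d. Lterm d z s n)"

text \<open>Values at \<open>1\<close> of the characters
  \<open>partial_prod f 2, f 3, f 4, ...\<close>. If \<open>z 1 = 1\<close> they are those of
  \<open>f 2, f 3, ...\<close>, so both identities refer to the same series of lower depth.\<close>

definition merge_char :: "(nat \<Rightarrow> complex) \<Rightarrow> nat \<Rightarrow> complex" where
  "merge_char z = (\<lambda>i. if i = 1 then z 1 * z 2 else z (Suc i))"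

lemma prod_merge_char:
  assumes "1 \<le> i"
  shows "(\<Prod>j\<in>{1..i}. merge_char z j) = (\<Prod>j\<in>{1..Suc i}. z j)"
  using assms
proof (induction i rule: dec_induct)
  case base
  have "{1..Suc 1} = {1, 2 :: nat}" by auto
  then show ?case by (simp add: merge_char_def)
next
  case (step n)
  then show ?case by (simp add: merge_char_def)
qed

lemma bounded_merge_char: "bounded_partial_prods (Suc d) z \<Longrightarrow> bounded_partial_prods d (merge_char z)"
  unfolding bounded_partial_prods_def
proof (intro ballI)
  fix i assume *: "\<forall>i\<in>{1..Suc d}. cmod (\<Prod>j\<in>{1..i}. z j) \<le> 1" and i: "i \<in> {1..d}"
  have "cmod (\<Prod>j\<in>{1..Suc i}. z j) \<le> 1" using i by (intro *[rule_format]) auto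
  then show "cmod (\<Prod>j\<in>{1..i}. merge_char z j) \<le> 1" using i by (subst prod_merge_char) auto
qed

lemma sum_merge_first:
  assumes "1 \<le> i" "i \<le> d"
  shows "(\<Sum>j\<in>{1..i}. merge_first (Suc d) c s j) = (\<Sum>j\<in>{1..Suc i}. s j) + c"
  using assms
proof (induction i rule: dec_induct)
  case base
  have "{1..Suc 1} = {1, 2 :: nat}" by auto
  then show ?case using assms by (simp add: merge_first_def)
next
  case (step n)
  then show ?case by (simp add: merge_first_def)
qed

lemma merge_first_Cn: "merge_first (Suc d) c s \<in> Cn d"
  by (auto simp: merge_first_def Cn_eq)

text \<open>The \<open>i\<close>-th partial sum at the merged point is the next partial sum of
  \<open>s\<close> plus \<open>c\<close>, so its real part exceeds \<open>i + 1 + Re c\<close>; this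
  leaves room for an offset down to \<open>- 1\<close>.\<close>

lemma merge_first_multL_domain:
  assumes "s \<in> multL_domain (Suc d)" "Re c \<ge> - 1"
  shows "merge_first (Suc d) c s \<in> multL_domain d"
proof -
  have "real i < Re (\<Sum>j\<in>{1..i}. merge_first (Suc d) c s j)" if "i \<in> {1..d}" for i
  proof -
    have "Suc i \<in> {1..Suc d}" using that by auto
    then have "real (Suc i) < Re (\<Sum>j\<in>{1..Suc i}. s j)"
      using assms(1) unfolding multL_domain_def by blast
    moreover have "Re (\<Sum>j\<in>{1..i}. merge_first (Suc d) c s j) = Re (\<Sum>j\<in>{1..Suc i}. s j) + Re c"
      using that by (subst sum_merge_first) auto
    ultimately show ?thesis using assms(2) by simp
  qed
  then show ?thesis using merge_first_Cn unfolding multL_domain_def by blast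
qed

lemma holomorphic_Cn_merge_first:
  assumes "1 \<le> d" "holomorphic_Cn d (Cn d) f"
  shows "holomorphic_Cn (Suc d) (Cn (Suc d)) (\<lambda>s. f (merge_first (Suc d) c s))"
proof (rule holomorphic_Cn_compose[OF assms(2)])
  show "continuous_on (Cn (Suc d)) (merge_first (Suc d) c)"
  proof (rule continuous_on_coordinatewise_then_product)
    fix i
    have coord: "continuous_on (Cn (Suc d)) (\<lambda>s. s j)" for j :: nat
      by (rule continuous_on_subset[OF continuous_on_product_coordinates]) auto
    show "continuous_on (Cn (Suc d)) (\<lambda>s. merge_first (Suc d) c s i)"
      unfolding merge_first_def restrict_def
      by (cases "i = 1"; cases "i \<in> {1..Suc d - 1}") (auto intro!: continuous_intros coord)
  qed
  fix a :: "nat \<Rightarrow> complex" and i assume i: "i \<in> {1..Suc d}"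
  let ?m = "merge_first (Suc d) c"
  consider "i = 1" | "i = 2" | "i \<ge> 3" using i by force
  then show "\<exists>j\<in>{1..d}. \<exists>b. \<forall>z. ?m (a(i := z)) = (?m a)(j := z + b)"
  proof cases
    case 1
    have "?m (a(1 := z)) = (?m a)(1 := z + (a 2 + c))" for z
      using assms(1) by (auto simp: merge_first_def restrict_def fun_eq_iff)
    then show ?thesis using assms(1) 1 by (intro bexI[of _ 1] exI) auto
  next
    case 2
    have "?m (a(2 := z)) = (?m a)(1 := z + (a 1 + c))" for z
      using assms(1) by (auto simp: merge_first_def restrict_def fun_eq_iff)
    then show ?thesis using assms(1) 2 by (intro bexI[of _ 1] exI) auto
  next
    case 3
    have "?m (a(i := z)) = (?m a)(i - 1 := z + 0)" for z
      using i 3 by (auto simp: merge_first_def restrict_def fun_eq_iff)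
    then show ?thesis using i 3 by (intro bexI[of _ "i - 1"] exI) auto
  qed
qed (auto simp: merge_first_Cn)

lemma gamma_factor_Suc:
  "gamma_factor (Suc d) s = rGamma (s 1 - 1) *
     (\<Prod>i\<in>{1..d}. rGamma ((\<Sum>j\<in>{1..Suc i}. s j) - of_nat (Suc i)))"
proof -
  have "gamma_factor (Suc d) s = rGamma ((\<Sum>j\<in>{1..1}. s j) - of_nat 1) *
     (\<Prod>i\<in>{Suc 1..Suc d}. rGamma ((\<Sum>j\<in>{1..i}. s j) - of_nat i))"
    unfolding gamma_factor_def by (rule prod.atLeast_Suc_atMost) simp
  then show ?thesis by (simp only: prod.shift_bounds_cl_Suc_ivl) simp
qed

text \<open>After the offset \<open>- 1\<close> each factor at the merged point equals the next
  factor at \<open>s\<close>, so only the factor \<open>i = 1\<close> is left over. Written as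
  \<open>(s 1 - 1) * rGamma (s 1)\<close>, it displays the zero that
  \<open>continuation_trivial\<close> divides out.\<close>

lemma gamma_factor_merge_pred:
  "gamma_factor (Suc d) s = (s 1 - 1) * rGamma (s 1) * gamma_factor d (merge_first (Suc d) (- 1) s)"
proof -
  have "gamma_factor d (merge_first (Suc d) (- 1) s) =
     (\<Prod>i\<in>{1..d}. rGamma ((\<Sum>j\<in>{1..Suc i}. s j) - of_nat (Suc i)))"
    unfolding gamma_factor_def
  proof (rule prod.cong[OF refl])
    fix i assume "i \<in> {1..d}"
    then have "(\<Sum>j\<in>{1..i}. merge_first (Suc d) (- 1) s j) = (\<Sum>j\<in>{1..Suc i}. s j) + - 1"
      by (intro sum_merge_first) auto
    then show "rGamma ((\<Sum>j\<in>{1..i}. merge_first (Suc d) (- 1) s j) - of_nat i) =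
        rGamma ((\<Sum>j\<in>{1..Suc i}. s j) - of_nat (Suc i))"
      by (simp only:) (simp add: algebra_simps)
  qed
  then show ?thesis using rGamma_plus1[of "s 1 - 1"] by (simp add: gamma_factor_Suc)
qed

text \<open>Without the offset the arguments are one too large, and the functional equation of
  \<open>rGamma\<close> repairs each at the cost of a linear form.\<close>

lemma gamma_factor_merge:
  "gamma_factor (Suc d) s = rGamma (s 1 - 1) *
     (\<Prod>i\<in>{1..d}. (\<Sum>j\<in>{1..Suc i}. s j) + - of_nat (Suc i)) * gamma_factor d (merge_first (Suc d) 0 s)"
proof -
  have "gamma_factor d (merge_first (Suc d) 0 s) =
     (\<Prod>i\<in>{1..d}. rGamma ((\<Sum>j\<in>{1..Suc i}. s j) - of_nat (Suc i) + 1))"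
    unfolding gamma_factor_def
  proof (rule prod.cong[OF refl])
    fix i assume "i \<in> {1..d}"
    then have "(\<Sum>j\<in>{1..i}. merge_first (Suc d) 0 s j) = (\<Sum>j\<in>{1..Suc i}. s j) + 0"
      by (intro sum_merge_first) auto
    then show "rGamma ((\<Sum>j\<in>{1..i}. merge_first (Suc d) 0 s j) - of_nat i) =
        rGamma ((\<Sum>j\<in>{1..Suc i}. s j) - of_nat (Suc i) + 1)"
      by (simp only:) (simp add: algebra_simps)
  qed
  then have "(\<Prod>i\<in>{1..d}. (\<Sum>j\<in>{1..Suc i}. s j) + - of_nat (Suc i)) * gamma_factor d (merge_first (Suc d) 0 s) =
     (\<Prod>i\<in>{1..d}. rGamma ((\<Sum>j\<in>{1..Suc i}. s j) - of_nat (Suc i)))"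
    by (simp only: prod.distrib[symmetric] rGamma_plus1 add_uminus_conv_diff)
  then show ?thesis by (simp only: gamma_factor_Suc mult.assoc)
qed

lemma Lfull_eq_Ltail: "2 \<le> d \<Longrightarrow> Lfull d z = Ltail d z"
  by (simp add: Lfull_def Ltail_def big_tuples_eq fun_eq_iff)

text \<open>The gamma factor of depth \<open>d + 1\<close> is an entire multiple of the one of depth
  \<open>d\<close> at the merged point. Multiplying \<open>H'\<close> by that entire function,
  without \<open>s 1 - 1\<close> if \<open>z 1 = 1\<close>, yields the required \<open>A\<close>.
  The identities are part of the conclusion because they must hold for this same pair
  \<open>H\<close>, \<open>H'\<close>.\<close>

lemma extension_step:
  assumes d: "1 \<le> d" and z: "bounded_partial_prods (Suc d) z"
    and H': "holomorphic_Cn d (Cn d) H'"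
      "\<And>s. s \<in> multL_domain d \<Longrightarrow> H' s = gamma_factor d s * Lfull d (merge_char z) s"
  shows "\<exists>H. holomorphic_Cn (Suc d) (Cn (Suc d)) H \<and>
    (\<forall>s\<in>multL_domain (Suc d). H s = gamma_factor (Suc d) s * Lfull (Suc d) z s) \<and>
    (\<forall>s\<in>Cn (Suc d). gamma_factor (Suc d) s \<noteq> 0 \<longrightarrow>
      (z 1 = 1 \<longrightarrow> (\<Sum>\<^sub>\<infinity>k. rising (s 1 - 1) k *
          (H (shift_first k s) / gamma_factor (Suc d) (shift_first k s))) =
        H' (merge_first (Suc d) (- 1) s) / gamma_factor d (merge_first (Suc d) (- 1) s)) \<and>
      (z 1 \<noteq> 1 \<longrightarrow> (\<Sum>\<^sub>\<infinity>k. rising (s 1) k *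
          (H (shift_first (Suc k) s) / gamma_factor (Suc d) (shift_first (Suc k) s))) =
        z 1 * (H' (merge_first (Suc d) 0 s) / gamma_factor d (merge_first (Suc d) 0 s)) +
        (z 1 - 1) * (H s / gamma_factor (Suc d) s)))"
proof -
  let ?r = "Suc d"
  have Lf: "Lfull ?r z = Ltail ?r z" using d by (intro Lfull_eq_Ltail) simp
  have Cn: "openin (cspace ?r) (Cn ?r)" by simp
  have diag: "Ldiag d z (s(1 := s 1 + c)) = Lfull d (merge_char z) (merge_first ?r c s)" for s c
    unfolding Ldiag_merge[OF d] Lfull_def merge_char_def ..
  show ?thesis
  proof (cases "z 1 = 1")
    case True
    define A where "A = (\<lambda>s. rGamma (s 1) * H' (merge_first ?r (- 1) s))"
    have "\<exists>H. holomorphic_Cn ?r (Cn ?r) H \<and>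
      (\<forall>s\<in>multL_domain ?r. H s = gamma_factor ?r s * Ltail ?r z s) \<and>
      (\<forall>s\<in>Cn ?r. gamma_factor ?r s \<noteq> 0 \<longrightarrow>
         (\<Sum>\<^sub>\<infinity>k. rising (s 1 - 1) k *
            (H (shift_first k s) / gamma_factor ?r (shift_first k s))) =
         (s 1 - 1) * A s / gamma_factor ?r s)"
    proof (rule continuation_trivial[OF z True])
      show "holomorphic_Cn ?r (Cn ?r) A"
        unfolding A_def
        by (intro holomorphic_Cn_mult holomorphic_Cn_merge_first d H' holomorphic_Cn_compose1[where g = rGamma]
              holomorphic_rGamma holomorphic_Cn_coord Cn)
      fix s assume s: "s \<in> multL_domain ?r"
      have "H' (merge_first ?r (- 1) s) =
         gamma_factor d (merge_first ?r (- 1) s) * Lfull d (merge_char z) (merge_first ?r (- 1) s)"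
        by (rule H'(2)[OF merge_first_multL_domain[OF s]]) simp
      then show "(s 1 - 1) * A s = gamma_factor ?r s * Ldiag d z (s(1 := s 1 - 1))"
        using diag[of s "- 1"] by (simp add: A_def gamma_factor_merge_pred)
    qed
    moreover have "(s 1 - 1) * A s / gamma_factor ?r s =
        H' (merge_first ?r (- 1) s) / gamma_factor d (merge_first ?r (- 1) s)"
      if "gamma_factor ?r s \<noteq> 0" for s
      using that unfolding A_def gamma_factor_merge_pred by simp
    ultimately show ?thesis using True unfolding Lf by auto
  next
    case False
    define A where "A = (\<lambda>s. rGamma (s 1 - 1) *
      (\<Prod>i\<in>{1..d}. (\<Sum>j\<in>{1..Suc i}. s j) + - of_nat (Suc i)) * H' (merge_first ?r 0 s))"
    obtain H where H: "holomorphic_Cn ?r (Cn ?r) H"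
      "\<And>s. s \<in> multL_domain ?r \<Longrightarrow> H s = gamma_factor ?r s * Ltail ?r z s"
      "\<And>s. s \<in> Cn ?r \<Longrightarrow> gamma_factor ?r s \<noteq> 0 \<Longrightarrow>
         (\<Sum>\<^sub>\<infinity>k. rising (s 1) k *
            (H (shift_first (Suc k) s) / gamma_factor ?r (shift_first (Suc k) s))) =
         z 1 * (A s / gamma_factor ?r s) + (z 1 - 1) * (H s / gamma_factor ?r s)"
    proof (atomize_elim, simp only: all_simps Ball_def[symmetric] imp_conjL, rule continuation_nontrivial[OF z False])
      have "holomorphic_Cn ?r (Cn ?r) (\<lambda>s. rGamma (s 1 + - 1))"
        by (rule holomorphic_Cn_compose1[OF _ holomorphic_rGamma])
           (intro holomorphic_Cn_add holomorphic_Cn_coord holomorphic_Cn_const Cn)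
      then show "holomorphic_Cn ?r (Cn ?r) A"
        unfolding A_def
        by (intro holomorphic_Cn_mult holomorphic_Cn_prod holomorphic_Cn_partial_sum
              holomorphic_Cn_merge_first d H' Cn) simp
      fix s assume s: "s \<in> multL_domain ?r"
      have "H' (merge_first ?r 0 s) =
         gamma_factor d (merge_first ?r 0 s) * Lfull d (merge_char z) (merge_first ?r 0 s)"
        by (rule H'(2)[OF merge_first_multL_domain[OF s]]) simp
      then show "A s = gamma_factor ?r s * Ldiag d z s"
        using diag[of s 0] by (simp only: A_def gamma_factor_merge add_0_right fun_upd_triv mult.assoc)
    qed
    have A_quot: "A s / gamma_factor ?r s =
        H' (merge_first ?r 0 s) / gamma_factor d (merge_first ?r 0 s)"
      if "gamma_factor ?r s \<noteq> 0" for s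
      using that unfolding A_def gamma_factor_merge by simp
    show ?thesis
      unfolding Lf
    proof (intro exI[of _ H] conjI ballI impI)
      show "holomorphic_Cn ?r (Cn ?r) H" by (rule H)
      show "H s = gamma_factor ?r s * Ltail ?r z s" if "s \<in> multL_domain ?r" for s
        by (rule H(2)[OF that])
      fix s assume s: "s \<in> Cn ?r" "gamma_factor ?r s \<noteq> 0"
      show "(\<Sum>\<^sub>\<infinity>k. rising (s 1) k *
          (H (shift_first (Suc k) s) / gamma_factor ?r (shift_first (Suc k) s))) =
        z 1 * (H' (merge_first ?r 0 s) / gamma_factor d (merge_first ?r 0 s)) +
        (z 1 - 1) * (H s / gamma_factor ?r s)"
        by (rule H(3)[OF s, unfolded A_quot[OF s(2)]])
    qed (use False in simp)
  qed
qed

lemma decreasing_tuples_1: "decreasing_tuples 1 = insert (\<lambda>i\<in>{1}. 1) (big_tuples 1)"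
proof -
  have "n = (\<lambda>i\<in>{1}. 1)" if n: "n \<in> decreasing_tuples 1" "\<not> 2 \<le> n 1" for n
  proof
    fix i
    have "n 1 = 1" using n decreasing_tuples_pos[OF n(1), of 1] by simp
    moreover have "n \<in> extensional {1}" using n(1) by (simp add: decreasing_tuples_def PiE_iff)
    ultimately show "n i = (\<lambda>i\<in>{1}. 1) i" by (cases "i = 1") (auto simp: extensional_def)
  qed
  moreover have "(\<lambda>i\<in>{1}. 1) \<in> decreasing_tuples 1"
    by (auto simp: decreasing_tuples_def)
  ultimately show ?thesis unfolding big_tuples_def by blast
qed

text \<open>The recursion also continues depth one, with the constant diagonal \<open>z 1\<close>;
  for \<open>z 1 = 1\<close> the quotient \<open>A\<close> is \<open>rGamma (s 1)\<close>. The tuple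
  with entry \<open>1\<close>, left out of the tail, contributes the constant \<open>z 1\<close>,
  which is added back.\<close>

lemma extension_1:
  assumes z: "bounded_partial_prods 1 z"
  shows "\<exists>H. holomorphic_Cn 1 (Cn 1) H \<and>
    (\<forall>s\<in>multL_domain 1. H s = gamma_factor 1 s * Lfull 1 z s)"
proof -
  have Cn: "openin (cspace 1) (Cn 1)" by simp
  have z': "bounded_partial_prods (Suc 0) z" using z by simp
  have Q1: "gamma_factor 1 s = (s 1 - 1) * rGamma (s 1)" for s
    using rGamma_plus1[of "s 1 - 1"] by (simp add: gamma_factor_def)
  have "\<exists>H. holomorphic_Cn 1 (Cn 1) H \<and>
    (\<forall>s\<in>multL_domain 1. H s = gamma_factor 1 s * Ltail 1 z s)"
  proof (cases "z 1 = 1")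
    case True
    have "holomorphic_Cn 1 (Cn 1) (\<lambda>s. rGamma (s 1))"
      by (intro holomorphic_Cn_compose1[where g = rGamma] holomorphic_rGamma holomorphic_Cn_coord Cn)
    then show ?thesis
      using continuation_trivial[OF z' True, of "\<lambda>s. rGamma (s 1)"] Q1 True by (auto simp: Ldiag_0)
  next
    case False
    have "holomorphic_Cn 1 (Cn 1) (\<lambda>s. gamma_factor 1 s * z 1)"
      by (intro holomorphic_Cn_mult holomorphic_Cn_gamma_factor holomorphic_Cn_const Cn)
    then show ?thesis
      using continuation_nontrivial[OF z' False, of "\<lambda>s. gamma_factor 1 s * z 1"]
      by (auto simp: Ldiag_0)
  qed
  then obtain H where H: "holomorphic_Cn 1 (Cn 1) H"
    "\<And>s. s \<in> multL_domain 1 \<Longrightarrow> H s = gamma_factor 1 s * Ltail 1 z s"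
    by blast
  have "Lfull 1 z s = z 1 + Ltail 1 z s" if "s \<in> multL_domain 1" for s
    unfolding Lfull_def Ltail_def decreasing_tuples_1
    by (subst infsum_insert[OF Lterm_summable[OF z that big_tuples_subset]])
       (auto simp: big_tuples_def Lterm_def)
  then have "\<forall>s\<in>multL_domain 1. H s + gamma_factor 1 s * z 1 = gamma_factor 1 s * Lfull 1 z s"
    using H(2) by (auto simp: algebra_simps)
  moreover have "holomorphic_Cn 1 (Cn 1) (\<lambda>s. H s + gamma_factor 1 s * z 1)"
    by (intro holomorphic_Cn_add H holomorphic_Cn_mult holomorphic_Cn_gamma_factor holomorphic_Cn_const Cn)
  ultimately show ?thesis by blast
qed

lemma extension_ex:
  assumes "1 \<le> d" "bounded_partial_prods d z"
  shows "\<exists>H. holomorphic_Cn d (Cn d) H \<and>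
    (\<forall>s\<in>multL_domain d. H s = gamma_factor d s * Lfull d z s)"
  using assms
proof (induction d arbitrary: z rule: dec_induct)
  case base
  then show ?case by (rule extension_1)
next
  case (step d)
  obtain H' where "holomorphic_Cn d (Cn d) H'"
    "\<And>s. s \<in> multL_domain d \<Longrightarrow> H' s = gamma_factor d s * Lfull d (merge_char z) s"
    using step.IH[OF bounded_merge_char[OF step.prems]] by blast
  from extension_step[OF step.hyps(1) step.prems this] show ?case by blast
qed

section \<open>Normal convergence of the series of meromorphic functions\<close>

lemma gamma_factor_shift_nonzero: "gamma_factor r s \<noteq> 0 \<Longrightarrow> gamma_factor r (shift_first k s) \<noteq> 0"
proof (induction k)
  case (Suc k)
  have "shift_first 1 (shift_first k s) = shift_first (Suc k) s" by (simp add: shift_first_add)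
  then show ?case using Suc gamma_factor_shift_1[of r "shift_first k s"] by auto
qed simp

lemma mero_eq_refl: "openin (cspace r) V \<Longrightarrow> mero_eq r V f f"
  unfolding mero_eq_def by (intro exI[of _ V]) (simp add: closure_of_subset openin_subset)

text \<open>A translate of the gamma factor divides the factor itself, so its nonvanishing set
  contains a set known to be dense.\<close>

lemma meromorphic_Cn_quotient:
  assumes r: "1 \<le> r" and H: "holomorphic_Cn r (Cn r) H"
  shows "meromorphic_Cn r (Cn r) (\<lambda>s. H s / gamma_factor r (shift_first k s))"
proof -
  have Cn: "openin (cspace r) (Cn r)" by simp
  have "cspace r closure_of {s \<in> Cn r. gamma_factor r s \<noteq> 0} \<subseteq>
      cspace r closure_of {s \<in> Cn r. gamma_factor r (shift_first k s) \<noteq> 0}"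
    using gamma_factor_shift_nonzero by (intro closure_of_mono) blast
  with gamma_factor_dense[OF Cn r]
  have dense: "Cn r \<subseteq> cspace r closure_of {s \<in> Cn r. gamma_factor r (shift_first k s) \<noteq> 0}"
    by (rule order_trans)
  have "holomorphic_Cn r (Cn r) (\<lambda>s. gamma_factor r (shift_first k s))"
    using shift_first_Cn[OF _ r] by (intro holomorphic_Cn_shift_first[OF holomorphic_Cn_gamma_factor Cn])
  then show ?thesis
    unfolding meromorphic_Cn_def using Cn H dense mero_eq_refl[OF Cn] by blast
qed

text \<open>Covers both series, with \<open>\<tau> = - 1\<close>, \<open>p = 0\<close> for
  \<open>z 1 = 1\<close> and \<open>\<tau> = 0\<close>, \<open>p = 1\<close> otherwise. A compact
  set lies in a box, so from some \<open>N\<close> on all its translates lie in the domain, where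
  the terms are holomorphic and decay; the finite exceptional set is \<open>{..<N}\<close>.\<close>

lemma mero_has_sum_rising:
  fixes H :: "(nat \<Rightarrow> complex) \<Rightarrow> complex" and \<tau> :: complex and p r :: nat
  defines "F \<equiv> \<lambda>s. H s / gamma_factor r s"
  defines "h \<equiv> \<lambda>k s. rising (s 1 + \<tau>) k * F (shift_first (k + p) s)"
  assumes r: "1 \<le> r" and H: "holomorphic_Cn r (Cn r) H"
    and decay: "\<And>R. R > 0 \<Longrightarrow> \<exists>N C. C \<ge> 0 \<and> (\<forall>s\<in>coord_box r R. \<forall>k\<ge>N.
      shift_first k s \<in> multL_domain r \<and> cmod (F (shift_first k s)) \<le> C / 2 ^ k)"
    and sum: "\<And>s. s \<in> Cn r \<Longrightarrow> gamma_factor r s \<noteq> 0 \<Longrightarrow> (\<Sum>\<^sub>\<infinity>k. h k s) = T s"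
  shows "normally_summable r (Cn r) h UNIV \<and> mero_has_sum r (Cn r) h UNIV T"
proof -
  have Cn: "openin (cspace r) (Cn r)" by simp
  have mero: "meromorphic_Cn r (Cn r) (h k)" for k
  proof -
    have "holomorphic_Cn r (Cn r) (\<lambda>s. rising (s 1 + \<tau>) k * H (shift_first (k + p) s))"
      using shift_first_Cn[OF _ r]
      by (intro holomorphic_Cn_mult holomorphic_Cn_rising[OF Cn] holomorphic_Cn_shift_first[OF H Cn])
    from meromorphic_Cn_quotient[OF r this, of "k + p"] show ?thesis by (simp add: h_def F_def)
  qed
  have F_hol: "holomorphic_Cn r (multL_domain r) F"
    unfolding F_def
    by (intro holomorphic_Cn_divide holomorphic_Cn_subset[OF H] holomorphic_Cn_subset[OF holomorphic_Cn_gamma_factor]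
          openin_multL_domain multL_domain_subset gamma_factor_nonzero)
  have tail: "\<exists>N. normal_tail r (Cn r) h UNIV K {..<N} h"
    if K: "compactin (cspace r) K" "K \<noteq> {}" for K
  proof -
    obtain R where R: "R > 0" "K \<subseteq> coord_box r R" using compact_subset_coord_box[OF K(1)] by blast
    obtain N C where C: "C \<ge> 0"
      and N: "\<And>s k. s \<in> coord_box r R \<Longrightarrow> N \<le> k \<Longrightarrow> shift_first k s \<in> multL_domain r"
        "\<And>s k. s \<in> coord_box r R \<Longrightarrow> N \<le> k \<Longrightarrow> cmod (F (shift_first k s)) \<le> C / 2 ^ k"
      using decay[OF R(1)] by metis
    define g where "g = (\<lambda>k. rising_bound (R + cmod \<tau>) k / 2 ^ k * C)"
    have g: "g summable_on UNIV - {..<N}"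
      unfolding g_def using R rising_bound_summable[of "R + cmod \<tau>"]
      by (intro summable_on_cmult_left) (rule summable_on_subset_banach[of _ UNIV], auto)
    have bound: "cmod (h k s) \<le> g k" if s: "s \<in> K" and k: "N \<le> k" for k s
    proof -
      have sR: "s \<in> coord_box r R" using s R by blast
      have "cmod (F (shift_first (k + p) s)) \<le> C / 2 ^ (k + p)" using N(2)[OF sR] k by simp
      also have "\<dots> \<le> C / 2 ^ k" using C by (intro divide_left_mono power_increasing) auto
      finally have le: "cmod (F (shift_first (k + p) s)) \<le> C / 2 ^ k" .
      have "cmod (s 1) \<le> R" using sR r by (auto simp: coord_box_def intro: less_imp_le)
      then have "cmod (s 1 + \<tau>) \<le> R + cmod \<tau>" using norm_triangle_ineq[of "s 1" \<tau>] by linarith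
      then have "cmod (h k s) \<le> rising_bound (R + cmod \<tau>) k * (C / 2 ^ k)"
        unfolding h_def norm_mult using R le
        by (intro mult_mono norm_rising_le) (auto intro!: rising_bound_nonneg)
      then show ?thesis by (simp add: g_def)
    qed
    obtain s0 where s0: "s0 \<in> K" using K by blast
    have "(\<lambda>k. SUP s\<in>K. cmod (h k s)) summable_on UNIV - {..<N}"
    proof (rule summable_on_comparison_test[OF g])
      fix k assume k: "k \<in> UNIV - {..<N}"
      show "(SUP s\<in>K. cmod (h k s)) \<le> g k" using K(2) bound k by (intro cSUP_least) auto
      have "bdd_above ((\<lambda>s. cmod (h k s)) ` K)" using bound k by (intro bdd_aboveI[of _ "g k"]) auto
      from cSUP_upper[OF s0 this] show "0 \<le> (SUP s\<in>K. cmod (h k s))"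
        using norm_ge_zero order_trans by blast
    qed
    moreover have "\<exists>V. K \<subseteq> V \<and> V \<subseteq> Cn r \<and> holomorphic_Cn r V (h k) \<and> mero_eq r V (h k) (h k)"
      if k: "k \<in> UNIV - {..<N}" for k
    proof (intro exI conjI)
      \<comment> \<open>The preimage of the whole domain under the translation serves as
        neighbourhood of \<open>K\<close>; \<open>F\<close> has no poles in the domain.\<close>
      let ?V = "{s \<in> Cn r. shift_first (k + p) s \<in> multL_domain r}"
      have V: "openin (cspace r) ?V" by (rule openin_shift_first_vimage[OF openin_multL_domain r])
      show "K \<subseteq> ?V" using R N(1) k by (auto simp: coord_box_def)
      show "holomorphic_Cn r ?V (h k)"
        unfolding h_def
        by (intro holomorphic_Cn_mult holomorphic_Cn_rising V holomorphic_Cn_shift_first[OF F_hol]) auto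
      show "mero_eq r ?V (h k) (h k)" by (rule mero_eq_refl[OF V])
    qed auto
    ultimately show ?thesis unfolding normal_tail_def by blast
  qed
  then have normal: "normally_summable r (Cn r) h UNIV"
    unfolding normally_summable_def using mero by blast
  \<comment> \<open>The identity is available pointwise off the zeros of the gamma factor; at a zero
    the quotients take the default value \<open>0\<close> of division. As the nonvanishing set is
    open and dense, this is enough for equality of meromorphic functions.\<close>
  have "mero_eq r (cspace r interior_of K) T (\<lambda>s. (\<Sum>k<N. h k s) + (\<Sum>\<^sub>\<infinity>k\<in>UNIV - {..<N}. h k s))"
    for K and N :: nat
    unfolding mero_eq_def
  proof (intro exI conjI ballI)
    let ?I = "cspace r interior_of K"
    let ?D = "{s \<in> ?I. gamma_factor r s \<noteq> 0}"
    show "openin (cspace r) ?D" by (rule openin_gamma_factor_nonzero) simp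
    show "?I \<subseteq> cspace r closure_of ?D" by (rule gamma_factor_dense[OF _ r]) simp
    fix s assume s: "s \<in> ?D"
    then have sC: "s \<in> Cn r" using interior_of_subset_topspace by fastforce
    obtain M C where M: "\<And>k. M \<le> k \<Longrightarrow> cmod (F (shift_first k s)) \<le> C / 2 ^ k" and C: "C \<ge> 0"
      using decay_at[OF decay sC] by metis
    have "(\<lambda>k. h k s) summable_on UNIV"
      unfolding h_def
    proof (rule summable_rising_mult[where N = M and C = C])
      fix k assume k: "M \<le> k"
      have "cmod (F (shift_first (k + p) s)) \<le> C / 2 ^ (k + p)" using M[of "k + p"] k by simp
      also have "\<dots> \<le> C / 2 ^ k" using C by (intro divide_left_mono power_increasing) auto
      finally show "cmod (F (shift_first (k + p) s)) \<le> C / 2 ^ k" .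
    qed
    then have "(\<lambda>k. h k s) summable_on UNIV - {..<N}" by (rule summable_on_subset_banach) auto
    then have "(\<Sum>\<^sub>\<infinity>k\<in>{..<N} \<union> (UNIV - {..<N}). h k s) = (\<Sum>k<N. h k s) + (\<Sum>\<^sub>\<infinity>k\<in>UNIV - {..<N}. h k s)"
      by (subst infsum_Un_disjoint) auto
    moreover have "{..<N} \<union> (UNIV - {..<N}) = UNIV" by auto
    ultimately show "T s = (\<Sum>k<N. h k s) + (\<Sum>\<^sub>\<infinity>k\<in>UNIV - {..<N}. h k s)"
      using sum[OF sC] s by simp
  qed auto
  then have "mero_has_sum r (Cn r) h UNIV T"
    unfolding mero_has_sum_def using normal tail by blast
  with normal show ?thesis by blast
qed

lemma multL_extension_quotient:
  assumes d: "1 \<le> d" and h: "\<And>i. i \<in> {1..d} \<Longrightarrow> additive_character (h i)"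
    and H: "holomorphic_Cn d (Cn d) H"
    and HL: "\<And>s. s \<in> multL_domain d \<Longrightarrow> H s = gamma_factor d s * Lfull d z s"
    and z: "\<And>i. i \<in> {1..d} \<Longrightarrow> z i = h i 1"
  shows "multL_extension d h (\<lambda>s. H s / gamma_factor d s)"
  unfolding multL_extension_def
proof (intro conjI ballI)
  show "meromorphic_Cn d (Cn d) (\<lambda>s. H s / gamma_factor d s)"
    using meromorphic_Cn_quotient[OF d H, of 0] by simp
  fix s assume s: "s \<in> multL_domain d"
  have "Lfull d z s = multL d h s"
  proof -
    have "Lfull d z s = (\<Sum>\<^sub>\<infinity>n\<in>decreasing_tuples d. Lterm d (\<lambda>i. h i 1) s n)"
      unfolding Lfull_def Lterm_def using z by (intro infsum_cong prod.cong) auto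
    then show ?thesis using multL_eq_Lterm[of d h s] h by simp
  qed
  then show "H s / gamma_factor d s = multL d h s"
    using HL[OF s] gamma_factor_nonzero[OF s] by simp
qed

theorem theorem4p1:
  fixes r :: nat and f :: "nat \<Rightarrow> int \<Rightarrow> complex"
  assumes "r \<ge> 2"
    and "\<And>i. i \<in> {1..r} \<Longrightarrow> additive_character (f i)"
    and "\<And>i. i \<in> {1..r} \<Longrightarrow> cmod (partial_prod f i 1) \<le> 1"
  shows "\<exists>F. multL_extension r f F \<and>
    (f 1 1 = 1 \<longrightarrow>
      (\<exists>G. multL_extension (r - 1) (\<lambda>i. f (Suc i)) G \<and>
        normally_summable r (Cn r)
          (\<lambda>k s. rising (s 1 - 1) k * F (s(1 := s 1 + of_nat k))) UNIV \<and>
        mero_has_sum r (Cn r)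
          (\<lambda>k s. rising (s 1 - 1) k * F (s(1 := s 1 + of_nat k))) UNIV
          (\<lambda>s. G (merge_first r (-1) s)))) \<and>
    (f 1 1 \<noteq> 1 \<longrightarrow>
      (\<exists>G. multL_extension (r - 1)
            (\<lambda>i. if i = 1 then partial_prod f 2 else f (Suc i)) G \<and>
        normally_summable r (Cn r)
          (\<lambda>k s. rising (s 1) k * F (s(1 := s 1 + of_nat k + 1))) UNIV \<and>
        mero_has_sum r (Cn r)
          (\<lambda>k s. rising (s 1) k * F (s(1 := s 1 + of_nat k + 1))) UNIV
          (\<lambda>s. f 1 1 * G (merge_first r 0 s) + (f 1 1 - 1) * F s)))"
proof -
  define d where "d = r - 1"
  have r: "r = Suc d" "1 \<le> d" "1 \<le> r" using assms(1) by (auto simp: d_def)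
  define z where "z = (\<lambda>i. f i 1)"
  have z: "bounded_partial_prods r z"
    using assms(3) by (simp add: bounded_partial_prods_def partial_prod_def z_def)
  have z': "bounded_partial_prods d (merge_char z)"
    using z r by (intro bounded_merge_char) simp
  obtain H' where H': "holomorphic_Cn d (Cn d) H'"
    "\<And>s. s \<in> multL_domain d \<Longrightarrow> H' s = gamma_factor d s * Lfull d (merge_char z) s"
    using extension_ex[OF r(2) z'] by blast
  obtain H where H: "holomorphic_Cn r (Cn r) H"
      "\<And>s. s \<in> multL_domain r \<Longrightarrow> H s = gamma_factor r s * Lfull r z s"
    and triv: "\<And>s. z 1 = 1 \<Longrightarrow> s \<in> Cn r \<Longrightarrow> gamma_factor r s \<noteq> 0 \<Longrightarrow>
      (\<Sum>\<^sub>\<infinity>k. rising (s 1 - 1) k * (H (shift_first k s) / gamma_factor r (shift_first k s))) =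
        H' (merge_first r (- 1) s) / gamma_factor d (merge_first r (- 1) s)"
    and nontriv: "\<And>s. z 1 \<noteq> 1 \<Longrightarrow> s \<in> Cn r \<Longrightarrow> gamma_factor r s \<noteq> 0 \<Longrightarrow>
      (\<Sum>\<^sub>\<infinity>k. rising (s 1) k * (H (shift_first (Suc k) s) / gamma_factor r (shift_first (Suc k) s))) =
        z 1 * (H' (merge_first r 0 s) / gamma_factor d (merge_first r 0 s)) +
        (z 1 - 1) * (H s / gamma_factor r s)"
    using extension_step[OF r(2) z[unfolded r(1)] H'] unfolding r(1)[symmetric] by blast
  define F where "F = (\<lambda>s. H s / gamma_factor r s)"
  define G where "G = (\<lambda>s. H' s / gamma_factor d s)"
  have F_ext: "multL_extension r f F"
    unfolding F_def using assms(2) H r by (intro multL_extension_quotient[where z = z]) (auto simp: z_def)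
  \<comment> \<open>For \<open>r \<ge> 2\<close> every tuple is big, so the decay of the tail is
    that of the full series.\<close>
  have L: "Lfull r z = Ltail r z" using assms(1) by (rule Lfull_eq_Ltail)
  have decay: "\<exists>N C. C \<ge> 0 \<and> (\<forall>s\<in>coord_box r R. \<forall>k\<ge>N.
      shift_first k s \<in> multL_domain r \<and> cmod (H (shift_first k s) / gamma_factor r (shift_first k s)) \<le> C / 2 ^ k)"
    if "R > 0" for R
    by (rule decay_cong[OF Ltail_decay[OF z r(3) that]])
       (use H(2) gamma_factor_nonzero L in auto)
  have G_ext: "multL_extension d h G"
    if "\<And>i. i \<in> {1..d} \<Longrightarrow> additive_character (h i)" "\<And>i. i \<in> {1..d} \<Longrightarrow> merge_char z i = h i 1" for h
    unfolding G_def using that H' r by (intro multL_extension_quotient[where z = "merge_char z"]) auto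
  have part1: "multL_extension (r - 1) (\<lambda>i. f (Suc i)) G \<and>
      normally_summable r (Cn r)
        (\<lambda>k s. rising (s 1 - 1) k * F (s(1 := s 1 + of_nat k))) UNIV \<and>
      mero_has_sum r (Cn r)
        (\<lambda>k s. rising (s 1 - 1) k * F (s(1 := s 1 + of_nat k))) UNIV
        (\<lambda>s. G (merge_first r (-1) s))" if z1: "f 1 1 = 1"
  proof -
    \<comment> \<open>Here \<open>merge_char z 1 = f 1 1 * f 2 1\<close> reduces to
      \<open>f 2 1\<close>.\<close>
    have "multL_extension d (\<lambda>i. f (Suc i)) G"
      using assms(2) r z1 by (intro G_ext) (auto simp: merge_char_def z_def numeral_2_eq_2)
    moreover have "(\<lambda>k s. rising (s 1 - 1) k * F (s(1 := s 1 + of_nat k))) =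
        (\<lambda>k s. rising (s 1 + - 1) k * (H (shift_first (k + 0) s) / gamma_factor r (shift_first (k + 0) s)))"
      by (simp add: F_def shift_first_def)
    moreover have "z 1 = 1" using z1 by (simp add: z_def)
    ultimately show ?thesis
      using mero_has_sum_rising[OF r(3) H(1) decay, where \<tau> = "- 1" and p = 0
          and T = "\<lambda>s. G (merge_first r (-1) s)"] triv
      by (simp add: d_def G_def)
  qed
  have part2: "multL_extension (r - 1) (\<lambda>i. if i = 1 then partial_prod f 2 else f (Suc i)) G \<and>
      normally_summable r (Cn r)
        (\<lambda>k s. rising (s 1) k * F (s(1 := s 1 + of_nat k + 1))) UNIV \<and>
      mero_has_sum r (Cn r)
        (\<lambda>k s. rising (s 1) k * F (s(1 := s 1 + of_nat k + 1))) UNIV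
        (\<lambda>s. f 1 1 * G (merge_first r 0 s) + (f 1 1 - 1) * F s)" if z1: "f 1 1 \<noteq> 1"
  proof -
    have "{1..2} = {1, 2 :: nat}" by auto
    then have p2: "partial_prod f 2 = (\<lambda>n. f 1 n * f 2 n)" by (simp add: partial_prod_def)
    have "additive_character (f 1)" "additive_character (f 2)" using assms(1,2) by auto
    then have "additive_character (partial_prod f 2)"
      unfolding p2 additive_character_def by (auto simp: mult_ac)
    then have "multL_extension d (\<lambda>i. if i = 1 then partial_prod f 2 else f (Suc i)) G"
      using assms(2) r by (intro G_ext) (auto simp: merge_char_def z_def p2)
    moreover have "(\<lambda>k s. rising (s 1) k * F (s(1 := s 1 + of_nat k + 1))) =
        (\<lambda>k s. rising (s 1 + 0) k * (H (shift_first (k + 1) s) / gamma_factor r (shift_first (k + 1) s)))"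
      by (simp add: F_def shift_first_def add_ac)
    moreover have "z 1 \<noteq> 1" using z1 by (simp add: z_def)
    ultimately show ?thesis
      using mero_has_sum_rising[OF r(3) H(1) decay, where \<tau> = 0 and p = 1
          and T = "\<lambda>s. f 1 1 * G (merge_first r 0 s) + (f 1 1 - 1) * F s"] nontriv
      by (simp add: d_def G_def F_def z_def)
  qed
  show ?thesis using F_ext part1 part2 by blast
qed

end
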